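(* Let $y=(y_{ij})_{i,j\ge0,\,i+j\le4}\in\mathcal{M}_{2,4}$. If the moment matrix $M_2(y)$ is positive semidefinite, then $y\in\overline{\mathcal{R}_{2,4}}$.
   Context: $\mathcal{M}_{2,4}$ is the space of all real families $(y_{ij})_{i,j\ge0,\,i+j\le4}$, identified with $\mathbb{R}^{15}$ with its Euclidean topology. $M_2(y)$ is the $6\times 6$ real symmetric matrix with rows and columns indexed by $\alpha,\beta\in\mathbb{Z}_+^2$ with $|\alpha|,|\beta|\le2$ (where $|\alpha|=\alpha_1+\alpha_2$), and $(\alpha,\beta)$ entry $y_{\alpha+\beta}$. $\mathcal{R}_{2,4}$ is the set of $y\in\mathcal{M}_{2,4}$ having a representing measure, i.e. a positive Borel measure $\mu$ on $\mathbb{R}^2$ with $y_{ij}=\int_{\mathbb{R}^2}x_1^ix_2^j\,d\mu(x)$ for all $i+j\le4$; the overline denotes closure. *)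

theory Defs
  imports "HOL-Analysis.Analysis"
begin

typedef multi_index2 = "{(i :: nat, j :: nat). i + j \<le> 2}"
  by (rule exI[of _ "(0, 0)"]) simp

typedef multi_index4 = "{(i :: nat, j :: nat). i + j \<le> 4}"
  by (rule exI[of _ "(0, 0)"]) simp

lemma finite_multi_indices: "finite {(i :: nat, j :: nat). i + j \<le> d}"
  by (rule finite_subset[of _ "{..d} \<times> {..d}"]) auto

lemma card_multi_indices:
  "card {(i :: nat, j :: nat). i + j \<le> d} = (\<Sum>i\<le>d. Suc (d - i))"
proof -
  have "{(i :: nat, j :: nat). i + j \<le> d} = (SIGMA i:{..d}. {..d - i})"
    by auto
  then show ?thesis
    by (simp add: card_SigmaI)
qed

instance multi_index2 :: finite
  by standard
    (metis finite_imageI finite_multi_indices type_definition.Abs_image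
      type_definition_multi_index2)

instance multi_index4 :: finite
  by standard
    (metis finite_imageI finite_multi_indices type_definition.Abs_image
      type_definition_multi_index4)

lemma CARD_multi_index2: "CARD(multi_index2) = 6"
  using type_definition.card[OF type_definition_multi_index2]
  by (simp add: card_multi_indices numeral_eq_Suc)

lemma CARD_multi_index4: "CARD(multi_index4) = 15"
  using type_definition.card[OF type_definition_multi_index4]
  by (simp add: card_multi_indices numeral_eq_Suc)

type_synonym moment_seq = "real ^ multi_index4"

text \<open>\<open>mom y i j\<close> is the entry \<open>y\<^sub>i\<^sub>j\<close>; it is only meaningful for \<open>i + j \<le> 4\<close>, because the
  abstraction function is unspecified outside the representing set.\<close>

definition mom :: "moment_seq \<Rightarrow> nat \<Rightarrow> nat \<Rightarrow> real" where
  "mom y i j = y $ Abs_multi_index4 (i, j)"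

definition moment_matrix :: "moment_seq \<Rightarrow> real ^ multi_index2 ^ multi_index2" where
  "moment_matrix y =
    (\<chi> a b. mom y (fst (Rep_multi_index2 a) + fst (Rep_multi_index2 b))
                 (snd (Rep_multi_index2 a) + snd (Rep_multi_index2 b)))"

definition positive_semidefinite :: "real ^ 'n ^ 'n \<Rightarrow> bool" where
  "positive_semidefinite A \<longleftrightarrow> transpose A = A \<and> (\<forall>v. 0 \<le> v \<bullet> (A *v v))"

text \<open>Integrability has to be required separately: the Bochner integral of a non-integrable
  function is \<open>0\<close> by convention.\<close>

definition representing_measure :: "(real ^ 2) measure \<Rightarrow> moment_seq \<Rightarrow> bool" where
  "representing_measure \<mu> y \<longleftrightarrow>
    sets \<mu> = sets borel \<and>
    (\<forall>i j. i + j \<le> 4 \<longrightarrow>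
      integrable \<mu> (\<lambda>x. x $ 1 ^ i * x $ 2 ^ j) \<and>
      mom y i j = (\<integral>x. x $ 1 ^ i * x $ 2 ^ j \<partial>\<mu>))"

definition representable_seqs :: "moment_seq set" where
  "representable_seqs = {y. \<exists>\<mu>. representing_measure \<mu> y}"

end

theory Submission
  imports Defs
begin

text \<open>The cone of representable sequences contains all nonnegative combinations of evaluations at
  points of the plane.  If \<open>y\<close> lay outside its closure, a hyperplane would separate \<open>y\<close> from
  these combinations; its normal vector \<open>a\<close> is the coefficient vector of a quartic polynomial that
  is nonnegative on the plane although \<open>a \<bullet> y < 0\<close>.  By Hilbert's theorem on ternary
  quartics such a polynomial is a sum of squares of quadratics, and positive semidefiniteness of the
  moment matrix says exactly that \<open>y\<close> is nonnegative on squares of quadratics: a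
  contradiction.

  Hilbert's theorem is replaced here by the statement that carries the proof of Choi and Lam:
  every nonzero nonnegative ternary quartic \<open>F\<close> satisfies \<open>q\<^sup>2 \<le> F\<close> for some nonzero quadratic form
  \<open>q\<close> (\<open>nonneg_quartic_dominates_square\<close>).  It suffices because a minimiser can take the place of
  an extreme ray: fix a functional that is positive on the nonzero nonnegative quartics, and let
  \<open>G\<close> minimise the quotient of \<open>y\<close> by this functional.  If the minimum were negative, then
  removing \<open>q\<^sup>2\<close> from \<open>G\<close> would leave a nonnegative quartic and would force \<open>y\<close> to be negative on
  \<open>q\<^sup>2\<close> (\<open>psd_moment_matrix_nonneg\<close>).

  The square \<open>q\<^sup>2\<close> is found according to the zeros of \<open>F\<close>.  Without zeros, compactness gives a
  multiple of \<open>(x\<^sup>2 + y\<^sup>2 + z\<^sup>2)\<^sup>2\<close>.  Otherwise a zero is moved to \<open>(1, 0, 0)\<close>, so that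
  \<open>F = x\<^sup>2 f + 2 x g + h\<close> with \<open>f\<close>, \<open>g\<close>, \<open>h\<close> binary forms in \<open>y\<close> and \<open>z\<close>, and completing the
  square in \<open>x\<close> gives \<open>f F = (x f + g)\<^sup>2 + (f h - g\<^sup>2)\<close>.  If \<open>f\<close> has a zero, it is a multiple of
  the square of a linear form and \<open>F\<close> is a square plus a binary form.  If \<open>f\<close> and the discriminant
  \<open>f h - g\<^sup>2\<close> are positive definite, \<open>F\<close> is at least their quotient.  If the discriminant
  vanishes somewhere, \<open>F\<close> has a second zero, and moving it to \<open>(0, 1, 0)\<close> reduces all
  coefficients to quadratic forms, where a zero of the discriminant can be exploited
  by factoring (\<open>dominates_square_two_zeros\<close>).\<close>

section \<open>Forms in two and three variables\<close>

text \<open>Homogeneous polynomials are treated as functions generated by multiplication with the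
  variables, so that closure under products and linear substitutions needs no
  computation with coefficients.  The coefficients are recovered in \<open>ternary_form_coeffs\<close>.\<close>

inductive ternary_form :: "nat \<Rightarrow> (real \<Rightarrow> real \<Rightarrow> real \<Rightarrow> real) \<Rightarrow> bool" where
  const: "ternary_form 0 (\<lambda>x y z. c)"
| times_x: "ternary_form n F \<Longrightarrow> ternary_form (Suc n) (\<lambda>x y z. x * F x y z)"
| times_y: "ternary_form n F \<Longrightarrow> ternary_form (Suc n) (\<lambda>x y z. y * F x y z)"
| times_z: "ternary_form n F \<Longrightarrow> ternary_form (Suc n) (\<lambda>x y z. z * F x y z)"
| add: "ternary_form n F \<Longrightarrow> ternary_form n G \<Longrightarrow> ternary_form n (\<lambda>x y z. F x y z + G x y z)"

lemma ternary_form_cmult: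
  "ternary_form n F \<Longrightarrow> ternary_form n (\<lambda>x y z. c * F x y z)"
proof (induction rule: ternary_form.induct)
  case (times_x n F)
  show ?case using ternary_form.times_x[OF times_x.IH] by (simp add: mult.left_commute)
next
  case (times_y n F)
  show ?case using ternary_form.times_y[OF times_y.IH] by (simp add: mult.left_commute)
next
  case (times_z n F)
  show ?case using ternary_form.times_z[OF times_z.IH] by (simp add: mult.left_commute)
next
  case (add n F G)
  show ?case using ternary_form.add[OF add.IH] by (simp add: distrib_left)
qed (rule ternary_form.const)

lemma ternary_form_mult:
  assumes "ternary_form m F" and G: "ternary_form n G"
  shows "ternary_form (m + n) (\<lambda>x y z. F x y z * G x y z)"
  using assms(1)
proof (induction rule: ternary_form.induct)
  case (const c)
  show ?case using ternary_form_cmult[OF G] by simp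
next
  case (times_x n F)
  show ?case using ternary_form.times_x[OF times_x.IH] by (simp add: mult.assoc)
next
  case (times_y n F)
  show ?case using ternary_form.times_y[OF times_y.IH] by (simp add: mult.assoc)
next
  case (times_z n F)
  show ?case using ternary_form.times_z[OF times_z.IH] by (simp add: mult.assoc)
next
  case (add n F G)
  show ?case using ternary_form.add[OF add.IH] by (simp add: distrib_right)
qed

lemma ternary_form_linear: "ternary_form 1 (\<lambda>x y z. a * x + b * y + c * z)"
  using ternary_form.add[OF ternary_form.add[OF ternary_form.times_x[OF ternary_form.const[of a]]
      ternary_form.times_y[OF ternary_form.const[of b]]]
      ternary_form.times_z[OF ternary_form.const[of c]]]
  by (simp add: mult.commute)

lemma ternary_form_subst:
  assumes "ternary_form n F" "ternary_form 1 l" "ternary_form 1 m" "ternary_form 1 k"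
  shows "ternary_form n (\<lambda>x y z. F (l x y z) (m x y z) (k x y z))"
  using assms(1)
proof (induction rule: ternary_form.induct)
  case (times_x n F)
  show ?case using ternary_form_mult[OF assms(2) times_x.IH] by simp
next
  case (times_y n F)
  show ?case using ternary_form_mult[OF assms(3) times_y.IH] by simp
next
  case (times_z n F)
  show ?case using ternary_form_mult[OF assms(4) times_z.IH] by simp
qed (auto intro: ternary_form.intros)

lemma ternary_form_scale:
  "ternary_form n F \<Longrightarrow> F (t * x) (t * y) (t * z) = t ^ n * F x y z"
  by (induction rule: ternary_form.induct) (auto simp: algebra_simps)

lemma ternary_form_continuous:
  assumes "ternary_form n F"
  shows "continuous_on S (\<lambda>p. F (fst p) (fst (snd p)) (snd (snd p)))"
  using assms
  by (induction rule: ternary_form.induct) (auto intro!: continuous_intros)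

lemma ternary_form_coeffs:
  assumes "ternary_form n F"
  shows "\<exists>c. \<forall>x y z. F x y z = (\<Sum>(i, j)\<in>{(i, j). i + j \<le> n}. c i j * x ^ i * y ^ j * z ^ (n - i - j))"
  using assms
proof (induction rule: ternary_form.induct)
  case (const c)
  have "{(i, j). i + j \<le> (0::nat)} = {(0, 0)}" by auto
  then show ?case by (intro exI[of _ "\<lambda>i j. c"]) simp
next
  case (times_x n F)
  then obtain c where
    c: "F x y z = (\<Sum>(i, j)\<in>{(i, j). i + j \<le> n}. c i j * x ^ i * y ^ j * z ^ (n - i - j))" for x y z
    by blast
  have "x * F x y z = (\<Sum>(i, j)\<in>{(i, j). i + j \<le> Suc n}.
      (if i = 0 then 0 else c (i - 1) j) * x ^ i * y ^ j * z ^ (Suc n - i - j))" for x y z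
    unfolding c sum_distrib_left
    by (intro sum.reindex_bij_witness_not_neutral[where S' = "{}"
          and T' = "{0} \<times> {..Suc n}" and i = "\<lambda>(i, j). (i - 1, j)" and j = "\<lambda>(i, j). (Suc i, j)"])
      (auto simp: algebra_simps finite_multi_indices split: if_splits)
  then show ?case by (intro exI[of _ "\<lambda>i j. if i = 0 then 0 else c (i - 1) j"]) blast
next
  case (times_y n F)
  then obtain c where
    c: "F x y z = (\<Sum>(i, j)\<in>{(i, j). i + j \<le> n}. c i j * x ^ i * y ^ j * z ^ (n - i - j))" for x y z
    by blast
  have "y * F x y z = (\<Sum>(i, j)\<in>{(i, j). i + j \<le> Suc n}.
      (if j = 0 then 0 else c i (j - 1)) * x ^ i * y ^ j * z ^ (Suc n - i - j))" for x y z
    unfolding c sum_distrib_left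
    by (intro sum.reindex_bij_witness_not_neutral[where S' = "{}"
          and T' = "{..Suc n} \<times> {0}" and i = "\<lambda>(i, j). (i, j - 1)" and j = "\<lambda>(i, j). (i, Suc j)"])
      (auto simp: algebra_simps finite_multi_indices split: if_splits)
  then show ?case by (intro exI[of _ "\<lambda>i j. if j = 0 then 0 else c i (j - 1)"]) blast
next
  case (times_z n F)
  then obtain c where
    c: "F x y z = (\<Sum>(i, j)\<in>{(i, j). i + j \<le> n}. c i j * x ^ i * y ^ j * z ^ (n - i - j))" for x y z
    by blast
  have "z * F x y z = (\<Sum>(i, j)\<in>{(i, j). i + j \<le> Suc n}.
      (if i + j \<le> n then c i j else 0) * x ^ i * y ^ j * z ^ (Suc n - i - j))" for x y z
    unfolding c sum_distrib_left
    by (intro sum.mono_neutral_cong_left finite_multi_indices)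
      (auto simp: algebra_simps Suc_diff_le split: if_splits)
  then show ?case by (intro exI[of _ "\<lambda>i j. if i + j \<le> n then c i j else 0"]) blast
next
  case (add n F G)
  then obtain c d where
    c: "F x y z = (\<Sum>(i, j)\<in>{(i, j). i + j \<le> n}. c i j * x ^ i * y ^ j * z ^ (n - i - j))" and
    d: "G x y z = (\<Sum>(i, j)\<in>{(i, j). i + j \<le> n}. d i j * x ^ i * y ^ j * z ^ (n - i - j))" for x y z
    by blast
  show ?case
    by (rule exI[of _ "\<lambda>i j. c i j + d i j"])
      (simp add: c d sum.distrib[symmetric] algebra_simps case_prod_unfold)
qed

text \<open>The coefficients are indexed by the exponent of \<open>y\<close> alone, so that dividing by \<open>z\<close> leaves them
  in place (\<open>binary_form_divisible\<close>).\<close>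

definition binary_form :: "nat \<Rightarrow> (nat \<Rightarrow> real) \<Rightarrow> real \<Rightarrow> real \<Rightarrow> real" where
  "binary_form n c y z = (\<Sum>i\<le>n. c i * y ^ i * z ^ (n - i))"

lemma binary_form_scale: "binary_form n c (t * y) (t * z) = t ^ n * binary_form n c y z"
proof -
  have "t ^ n = t ^ i * t ^ (n - i)" if "i \<le> n" for i
    using that by (simp flip: power_add)
  then show ?thesis
    unfolding binary_form_def sum_distrib_left
    by (intro sum.cong) (auto simp: power_mult_distrib)
qed

lemma binary_form_at_0: "n > 0 \<Longrightarrow> binary_form n c 0 0 = 0"
  using binary_form_scale[of n c 0 0 0] by (simp add: zero_power)

lemma continuous_binary_form [continuous_intros]:
  assumes "continuous_on S f" "continuous_on S g"
  shows "continuous_on S (\<lambda>p. binary_form n c (f p) (g p))"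
  unfolding binary_form_def by (intro continuous_intros assms)

lemma binary_form_divisible:
  "c (Suc n) = 0 \<Longrightarrow> binary_form (Suc n) c y z = z * binary_form n c y z"
  unfolding binary_form_def sum_distrib_left
  by (simp, intro sum.cong) (auto simp: Suc_diff_le)

lemma binary_form_at_1_0: "binary_form n c 1 0 = c n"
  by (simp add: binary_form_def power_0_left if_distrib cong: if_cong) 

lemma binary_form_ternary: "ternary_form n (\<lambda>x y z. binary_form n c y z)"
proof (induction n)
  case 0
  show ?case by (simp add: binary_form_def ternary_form.const)
next
  case (Suc n)
  have y: "ternary_form n (\<lambda>x y z. y ^ n)" for n
    by (induction n) (auto intro: ternary_form.intros)
  have "binary_form (Suc n) c y z = z * binary_form n c y z + c (Suc n) * y ^ Suc n" for y z
    unfolding binary_form_def sum_distrib_left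
    by (simp, intro sum.cong) (auto simp: Suc_diff_le)
  then show ?case
    using ternary_form.add[OF ternary_form.times_z[OF Suc] ternary_form_cmult[OF y]] by simp
qed

lemma ternary_form_expand:
  assumes "ternary_form n F"
  shows "\<exists>c. \<forall>x y z. F x y z = (\<Sum>k\<le>n. x ^ k * binary_form (n - k) (c k) y z)"
proof -
  obtain c where
    c: "F x y z = (\<Sum>(i, j)\<in>{(i, j). i + j \<le> n}. c i j * x ^ i * y ^ j * z ^ (n - i - j))" for x y z
    using ternary_form_coeffs[OF assms] by blast
  have "{(i, j). i + j \<le> n} = (SIGMA i:{..n}. {..n - i})" by auto
  then have "F x y z = (\<Sum>k\<le>n. x ^ k * binary_form (n - k) (c k) y z)" for x y z
    unfolding c binary_form_def sum_distrib_left
    by (simp add: sum.Sigma[symmetric] algebra_simps)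
  then show ?thesis by blast
qed

section \<open>Consequences of nonnegativity\<close>

text \<open>Discriminant inequalities are obtained off a line only, after division by a power of a linear form
  that vanishes on it; this lemma extends them to the line.\<close>

lemma nonneg_at_limit:
  fixes g :: "real \<Rightarrow> real"
  assumes "continuous_on UNIV g" "\<And>t. t \<noteq> a \<Longrightarrow> 0 \<le> g t"
  shows "0 \<le> g a"
proof (rule tendsto_lowerbound)
  show "(g \<longlongrightarrow> g a) (at a)"
    using assms(1) by (simp add: continuous_on_eq_continuous_at isCont_def)
  show "\<forall>\<^sub>F t in at a. 0 \<le> g t"
    using assms(2) by (auto simp: eventually_at_filter)
qed simp

lemma nonneg_quadratic:
  fixes a b c :: real
  assumes nonneg: "\<And>t. 0 \<le> a * t\<^sup>2 + 2 * b * t + c"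
  shows "0 \<le> a" "0 \<le> c" "b\<^sup>2 \<le> a * c"
proof -
  show c: "0 \<le> c" using nonneg[of 0] by simp
  show a: "0 \<le> a"
  proof (rule ccontr)
    assume "\<not> 0 \<le> a"
    then have "a < 0" by simp
    \<comment> \<open>Averaging the values at \<open>t\<close> and \<open>- t\<close> removes the linear term and leaves \<open>- 1\<close>.\<close>
    define t where "t = sqrt ((c + 1) / (- a))"
    have "t\<^sup>2 = (c + 1) / (- a)" using \<open>a < 0\<close> c by (simp add: t_def divide_nonneg_neg)
    then have "a * t\<^sup>2 = - (c + 1)" using \<open>a < 0\<close> by (simp add: field_simps)
    then show False using nonneg[of t] nonneg[of "- t"] by simp
  qed
  show "b\<^sup>2 \<le> a * c"
  proof (cases "a = 0")
    case True
    have "b = 0"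
    proof (rule ccontr)
      assume "b \<noteq> 0"
      then show False using nonneg[of "- (c + 1) / (2 * b)"] True by simp
    qed
    then show ?thesis using True by simp
  next
    case False
    then have "a > 0" using a by simp
    then have "0 \<le> a * (a * (- b / a)\<^sup>2 + 2 * b * (- b / a) + c)"
      using nonneg[of "- b / a"] by simp
    also have "\<dots> = a * c - b\<^sup>2" using False by (simp add: field_simps power2_eq_square)
    finally show ?thesis by simp
  qed
qed

text \<open>A cubic polynomial with nonzero leading coefficient takes negative values near one of the two
  infinities.  Hence a nonnegative quartic form that vanishes at a coordinate point does not contain
  the cubic power of that coordinate either.\<close>

lemma nonneg_cubic:
  fixes p q r s :: real
  assumes nonneg: "\<And>t. 0 \<le> p * t ^ 3 + q * t\<^sup>2 + r * t + s"
  shows "p = 0"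
proof -
  have False if pos: "p > 0" and nn: "\<And>t. 0 \<le> p * t ^ 3 + q * t\<^sup>2 + r * t + s" for p q r s :: real
  proof -
    \<comment> \<open>At \<open>- t\<close> the leading term outweighs the other three, because \<open>t \<ge> 1\<close>
      and \<open>p * t\<close> exceeds the sum of their absolute coefficients.\<close>
    define t where "t = 1 + (\<bar>q\<bar> + \<bar>r\<bar> + \<bar>s\<bar>) / p"
    have t: "1 \<le> t" using pos by (simp add: t_def)
    have pt: "p * t = p + \<bar>q\<bar> + \<bar>r\<bar> + \<bar>s\<bar>" using pos by (simp add: t_def field_simps)
    have "\<bar>q\<bar> * t\<^sup>2 + \<bar>r\<bar> * t + \<bar>s\<bar> * 1 \<le> \<bar>q\<bar> * t\<^sup>2 + \<bar>r\<bar> * t\<^sup>2 + \<bar>s\<bar> * t\<^sup>2"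
      using t by (intro add_mono mult_left_mono order_refl) (auto simp: power2_eq_square mult_ge1_I)
    moreover have "q * t\<^sup>2 \<le> \<bar>q\<bar> * t\<^sup>2" "- r * t \<le> \<bar>r\<bar> * t" "s \<le> \<bar>s\<bar>"
      using t mult_right_mono[of "- r" "\<bar>r\<bar>" t] by (auto intro!: mult_right_mono)
    moreover have "p * t ^ 3 = (p + \<bar>q\<bar> + \<bar>r\<bar> + \<bar>s\<bar>) * t\<^sup>2"
      unfolding pt[symmetric] by (simp add: power2_eq_square power3_eq_cube)
    moreover have "0 < p * t\<^sup>2" using pos t by simp
    moreover have "0 \<le> - p * t ^ 3 + q * t\<^sup>2 - r * t + s" using nn[of "- t"] by simp
    ultimately show False by (simp add: algebra_simps)
  qed
  from this[of p q r s] this[of "- p" q "- r" s] show ?thesis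
    using nonneg nonneg[of "- t" for t] by (fastforce simp: not_less_iff_gr_or_eq)
qed

text \<open>Compactness of the unit sphere turns strict positivity into a quantitative bound.\<close>

lemma homogeneous_lower_bound:
  fixes \<phi> :: "'a::euclidean_space \<Rightarrow> real"
  assumes cont: "continuous_on (- {0}) \<phi>"
    and hom: "\<And>t v. t > 0 \<Longrightarrow> v \<noteq> 0 \<Longrightarrow> \<phi> (t *\<^sub>R v) = t ^ n * \<phi> v"
    and pos: "\<And>v. v \<noteq> 0 \<Longrightarrow> 0 < \<phi> v"
  shows "\<exists>\<epsilon>>0. \<forall>v. v \<noteq> 0 \<longrightarrow> \<epsilon> * norm v ^ n \<le> \<phi> v"
proof -
  have "\<exists>u\<in>sphere (0::'a) 1. \<forall>v\<in>sphere 0 1. \<phi> u \<le> \<phi> v"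
    by (rule continuous_attains_inf) (auto intro: continuous_on_subset[OF cont])
  then obtain u where u: "norm u = 1" "\<And>v. norm v = 1 \<Longrightarrow> \<phi> u \<le> \<phi> v"
    by (auto simp: dist_norm)
  have "\<phi> u * norm v ^ n \<le> \<phi> v" if "v \<noteq> 0" for v
  proof -
    have "\<phi> u * norm v ^ n \<le> \<phi> (v /\<^sub>R norm v) * norm v ^ n"
      using that by (intro mult_right_mono u) auto
    also have "\<dots> = \<phi> v"
      using hom[of "norm v" "v /\<^sub>R norm v"] that by (simp add: mult.commute)
    finally show ?thesis .
  qed
  moreover have "\<phi> u > 0" using u by (intro pos) auto
  ultimately show ?thesis by blast
qed

lemma binary_lower_bound:
  fixes \<phi> :: "real \<Rightarrow> real \<Rightarrow> real"
  assumes "continuous_on (- {0}) (\<lambda>p. \<phi> (fst p) (snd p))"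
    and "\<And>t y z. t > 0 \<Longrightarrow> \<phi> (t * y) (t * z) = t ^ (2 * m) * \<phi> y z"
    and "\<And>y z. (y, z) \<noteq> (0, 0) \<Longrightarrow> 0 < \<phi> y z"
  shows "\<exists>\<epsilon>>0. \<forall>y z. (y, z) \<noteq> (0, 0) \<longrightarrow> \<epsilon> * (y\<^sup>2 + z\<^sup>2) ^ m \<le> \<phi> y z"
proof -
  have "\<exists>\<epsilon>>0. \<forall>v. v \<noteq> 0 \<longrightarrow> \<epsilon> * norm v ^ (2 * m) \<le> \<phi> (fst v) (snd v)"
  proof (rule homogeneous_lower_bound)
    show "0 < \<phi> (fst v) (snd v)" if "v \<noteq> 0" for v
      using assms(3)[of "fst v" "snd v"] that by (simp add: zero_prod_def prod_eq_iff)
  qed (use assms in auto)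
  then show ?thesis
    by (simp add: zero_prod_def norm_prod_def power_mult)
qed

section \<open>A square below a nonnegative quartic\<close>

definition dominates_square :: "(real \<Rightarrow> real \<Rightarrow> real \<Rightarrow> real) \<Rightarrow> bool" where
  "dominates_square F \<longleftrightarrow> (\<exists>q. ternary_form 2 q \<and> (\<exists>x y z. q x y z \<noteq> 0) \<and>
    (\<forall>x y z. (q x y z)\<^sup>2 \<le> F x y z))"

lemma dominates_squareI:
  assumes "ternary_form 2 q" "q x y z \<noteq> 0" "\<And>x y z. (q x y z)\<^sup>2 \<le> F x y z"
  shows "dominates_square F"
  using assms unfolding dominates_square_def by blast

lemma dominates_square_swap:
  assumes "dominates_square (\<lambda>x y z. F y x z)"
  shows "dominates_square F"
proof -
  obtain q a b c where q: "ternary_form 2 q" "q a b c \<noteq> 0" "\<And>x y z. (q x y z)\<^sup>2 \<le> F y x z"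
    using assms unfolding dominates_square_def by blast
  have "ternary_form 2 (\<lambda>x y z. q y x z)"
    using ternary_form_subst[OF q(1) ternary_form_linear[of 0 1 0] ternary_form_linear[of 1 0 0]
        ternary_form_linear[of 0 0 1]] by simp
  then show ?thesis by (rule dominates_squareI[of _ b a c]) (use q in auto)
qed

lemma ternary_form_swap:
  "ternary_form n F \<Longrightarrow> ternary_form n (\<lambda>x y z. F y x z)"
  using ternary_form_subst[OF _ ternary_form_linear[of 0 1 0] ternary_form_linear[of 1 0 0]
        ternary_form_linear[of 0 0 1], of n F] by simp

text \<open>For \<open>(b, c) \<noteq> (0, 0)\<close> this linear substitution is invertible.  It fixes \<open>(1, 0, 0)\<close> and sends
  \<open>(0, 1, 0)\<close> to \<open>(a, b, c)\<close>: a zero at \<open>(a, b, c)\<close> moves to \<open>(0, 1, 0)\<close> while a zero at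
  \<open>(1, 0, 0)\<close> stays where it is.\<close>

definition shift :: "real \<Rightarrow> real \<Rightarrow> real \<Rightarrow> (real \<Rightarrow> real \<Rightarrow> real \<Rightarrow> real) \<Rightarrow> real \<Rightarrow> real \<Rightarrow> real \<Rightarrow> real" where
  "shift a b c F x y z = F (x + a * y) (b * y - c * z) (c * y + b * z)"

lemma ternary_form_shift:
  "ternary_form n F \<Longrightarrow> ternary_form n (shift a b c F)"
  using ternary_form_subst[OF _ ternary_form_linear[of 1 a 0] ternary_form_linear[of 0 b "- c"]
        ternary_form_linear[of 0 c b], of n F] by (simp add: shift_def[abs_def])

lemma shift_inverse:
  assumes "(b, c) \<noteq> (0, 0)"
  shows "shift a b c F (x - a * ((b * y + c * z) / (b\<^sup>2 + c\<^sup>2)))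
    ((b * y + c * z) / (b\<^sup>2 + c\<^sup>2)) ((b * z - c * y) / (b\<^sup>2 + c\<^sup>2)) = F x y z"
proof -
  define s where "s = b\<^sup>2 + c\<^sup>2"
  have s: "s \<noteq> 0" using assms by (auto simp: s_def sum_power2_eq_zero_iff)
  have "b * ((b * y + c * z) / s) - c * ((b * z - c * y) / s) = s * y / s"
    "c * ((b * y + c * z) / s) + b * ((b * z - c * y) / s) = s * z / s"
    by (simp_all add: s_def algebra_simps power2_eq_square add_divide_distrib[symmetric]
        diff_divide_distrib[symmetric])
  then show ?thesis
    using s by (simp add: shift_def flip: s_def)
qed

corollary shift_nonzero:
  assumes "(b, c) \<noteq> (0, 0)" "F x y z \<noteq> 0"
  obtains u v w where "shift a b c F u v w \<noteq> 0"
proof (rule that)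
  show "shift a b c F (x - a * ((b * y + c * z) / (b\<^sup>2 + c\<^sup>2)))
      ((b * y + c * z) / (b\<^sup>2 + c\<^sup>2)) ((b * z - c * y) / (b\<^sup>2 + c\<^sup>2)) \<noteq> 0"
    unfolding shift_inverse[OF assms(1)] by (rule assms(2))
qed

lemma dominates_square_shift:
  assumes bc: "(b, c) \<noteq> (0, 0)" and "dominates_square (shift a b c F)"
  shows "dominates_square F"
proof -
  obtain q u v w where q: "ternary_form 2 q" "q u v w \<noteq> 0"
    "\<And>x y z. (q x y z)\<^sup>2 \<le> F (x + a * y) (b * y - c * z) (c * y + b * z)"
    using assms(2) unfolding dominates_square_def shift_def by blast
  define s where "s = b\<^sup>2 + c\<^sup>2"
  have s: "s \<noteq> 0" using bc by (auto simp: s_def sum_power2_eq_zero_iff)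
  define p where "p x y z = q (x - a * ((b * y + c * z) / s)) ((b * y + c * z) / s)
    ((b * z - c * y) / s)" for x y z
  have "ternary_form 2 p"
    using ternary_form_subst[OF q(1) ternary_form_linear[of 1 "- a * b / s" "- a * c / s"]
        ternary_form_linear[of 0 "b / s" "c / s"] ternary_form_linear[of 0 "- c / s" "b / s"]]
    by (simp add: p_def[abs_def] add_divide_distrib diff_divide_distrib algebra_simps)
  moreover have "p (u + a * v) (b * v - c * w) (c * v + b * w) \<noteq> 0"
  proof -
    have "b * (b * v - c * w) + c * (c * v + b * w) = s * v"
      "b * (c * v + b * w) - c * (b * v - c * w) = s * w"
      by (auto simp: s_def algebra_simps power2_eq_square)
    then show ?thesis using q(2) s by (simp add: p_def)
  qed
  moreover have "(p x y z)\<^sup>2 \<le> F x y z" for x y z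
    using q(3)[of "x - a * ((b * y + c * z) / s)" "(b * y + c * z) / s" "(b * z - c * y) / s"]
      shift_inverse[OF bc, of a F x y z, folded s_def] by (simp add: p_def shift_def)
  ultimately show ?thesis by (rule dominates_squareI)
qed

lemma atMost_4: "{..4::nat} = {0, 1, 2, 3, 4}" by auto

lemma binary_form_2: "binary_form 2 c y z = c 0 * z\<^sup>2 + c 1 * y * z + c 2 * y\<^sup>2"
  by (simp add: binary_form_def eval_nat_numeral)

lemma binary_form_divisible_numeral:
  "c 4 = 0 \<Longrightarrow> binary_form 4 c y z = z * binary_form 3 c y z"
  "c 3 = 0 \<Longrightarrow> binary_form 3 c y z = z * binary_form 2 c y z"
  using binary_form_divisible[of c 3 y z] binary_form_divisible[of c 2 y z]
  by (simp_all add: eval_nat_numeral)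

lemma binary_form_3_at_1: "binary_form 3 c y 1 = c 3 * y ^ 3 + c 2 * y\<^sup>2 + c 1 * y + c 0"
  by (simp add: binary_form_def eval_nat_numeral)

lemma dominates_square_positive:
  assumes F: "ternary_form 4 F" and pos: "\<And>x y z. (x, y, z) \<noteq> (0, 0, 0) \<Longrightarrow> 0 < F x y z"
  shows "dominates_square F"
proof -
  have "\<exists>\<epsilon>>0. \<forall>v. v \<noteq> 0 \<longrightarrow> \<epsilon> * norm v ^ (2 * 2) \<le> F (fst v) (fst (snd v)) (snd (snd v))"
  proof (rule homogeneous_lower_bound)
    show "0 < F (fst v) (fst (snd v)) (snd (snd v))" if "v \<noteq> 0" for v
      using pos[of "fst v" "fst (snd v)" "snd (snd v)"] that by (simp add: zero_prod_def prod_eq_iff)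
  qed (auto intro: ternary_form_continuous[OF F] simp: ternary_form_scale[OF F])
  then obtain \<epsilon> where \<epsilon>: "\<epsilon> > 0"
    "\<And>x y z. (x, y, z) \<noteq> (0, 0, 0) \<Longrightarrow> \<epsilon> * (x\<^sup>2 + (y\<^sup>2 + z\<^sup>2))\<^sup>2 \<le> F x y z"
    unfolding power_mult by (auto simp: zero_prod_def norm_prod_def)
  have "ternary_form 2 (\<lambda>x y z. sqrt \<epsilon> * (x * x + (y * y + z * z)))"
    using ternary_form_mult[OF ternary_form_linear ternary_form_linear, of 1 0 0 1 0 0]
      ternary_form_mult[OF ternary_form_linear ternary_form_linear, of 0 1 0 0 1 0]
      ternary_form_mult[OF ternary_form_linear ternary_form_linear, of 0 0 1 0 0 1]
    by (intro ternary_form_cmult ternary_form.add) (simp_all add: numeral_2_eq_2)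
  moreover have "sqrt \<epsilon> * (1 * 1 + (0 * 0 + 0 * 0)) \<noteq> 0" using \<epsilon> by simp
  moreover have "(sqrt \<epsilon> * (x * x + (y * y + z * z)))\<^sup>2 \<le> F x y z" for x y z
  proof (cases "(x, y, z) = (0, 0, 0)")
    case True
    then show ?thesis using ternary_form_scale[OF F, of 0] by simp
  next
    case False
    from \<epsilon>(2)[OF this] show ?thesis
      using \<epsilon>(1) by (simp add: power_mult_distrib flip: power2_eq_square)
  qed
  ultimately show ?thesis by (rule dominates_squareI)
qed

text \<open>The same alternative one dimension lower: without zeros, compactness applies; a zero, moved to
  \<open>(1, 0)\<close>, is a double zero, so that the quartic is \<open>z\<^sup>2\<close> times a nonzero nonnegative quadratic, which
  dominates the square of a linear form by completing the square.\<close>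

lemma dominates_square_binary:
  assumes nonneg: "\<And>y z. 0 \<le> binary_form 4 c y z" and nz: "binary_form 4 c y\<^sub>0 z\<^sub>0 \<noteq> 0"
  shows "dominates_square (\<lambda>x y z. binary_form 4 c y z)"
proof (cases "\<exists>b e. (b, e) \<noteq> (0, 0) \<and> binary_form 4 c b e = 0")
  case False
  have "\<exists>\<epsilon>>0. \<forall>y z. (y, z) \<noteq> (0, 0) \<longrightarrow> \<epsilon> * (y\<^sup>2 + z\<^sup>2) ^ 2 \<le> binary_form 4 c y z"
    by (rule binary_lower_bound) (use False nonneg in
      \<open>auto intro!: continuous_intros simp: binary_form_scale less_le\<close>)
  then obtain \<epsilon> where \<epsilon>: "\<epsilon> > 0"
    "\<And>y z. (y, z) \<noteq> (0, 0) \<Longrightarrow> \<epsilon> * (y\<^sup>2 + z\<^sup>2)\<^sup>2 \<le> binary_form 4 c y z" by blast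
  have "ternary_form 2 (\<lambda>x y z. sqrt \<epsilon> * (y * y + z * z))"
    using ternary_form_mult[OF ternary_form_linear ternary_form_linear, of 0 1 0 0 1 0]
      ternary_form_mult[OF ternary_form_linear ternary_form_linear, of 0 0 1 0 0 1]
    by (intro ternary_form_cmult ternary_form.add) (simp_all add: numeral_2_eq_2)
  moreover have "sqrt \<epsilon> * (1 * 1 + 0 * 0) \<noteq> 0" using \<epsilon> by simp
  moreover have "(sqrt \<epsilon> * (y * y + z * z))\<^sup>2 \<le> binary_form 4 c y z" for y z
    using \<epsilon>(2)[of y z] \<epsilon>(1) nonneg[of 0 0]
    by (cases "(y, z) = (0, 0)") (auto simp: power_mult_distrib simp flip: power2_eq_square)
  ultimately show ?thesis by (rule dominates_squareI)
next
  case True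
  then obtain b e where be: "(b, e) \<noteq> (0, 0)" "binary_form 4 c b e = 0" by blast
  define F where "F = shift 0 b e (\<lambda>x y z. binary_form 4 c y z)"
  have F: "ternary_form 4 F"
    unfolding F_def by (intro ternary_form_shift binary_form_ternary)
  then obtain d where d: "\<And>x y z. F x y z = (\<Sum>k\<le>4. x ^ k * binary_form (4 - k) (d k) y z)"
    using ternary_form_expand by blast
  define h where "h = d 0"
  have Fh: "F x y z = binary_form 4 h y z" for x y z
  proof -
    have "F x y z = F 0 y z" by (simp add: F_def shift_def)
    also have "\<dots> = binary_form 4 h y z" by (simp add: d atMost_4 h_def)
    finally show ?thesis .
  qed
  have h_nonneg: "0 \<le> binary_form 4 h y z" for y z
    using nonneg by (simp add: Fh[of 0, symmetric] F_def shift_def)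
  have "h 4 = 0"
    using be(2) Fh[of 0 1 0] by (simp add: binary_form_at_1_0 F_def shift_def)
  note h3 = binary_form_divisible_numeral(1)[of h, OF this]
  have "h 3 = 0"
    by (rule nonneg_cubic[of _ "h 2" "h 1" "h 0"])
      (use h_nonneg[of _ 1] in \<open>simp add: h3 binary_form_3_at_1\<close>)
  note h2 = h3[unfolded binary_form_divisible_numeral(2)[of h, OF this] binary_form_2]
  have "0 \<le> h 2 * t\<^sup>2 + 2 * (h 1 / 2) * t + h 0" for t
    using h_nonneg[of t 1] by (simp add: h2 algebra_simps)
  note k = nonneg_quadratic[OF this]
  have "dominates_square F"
  proof (cases "h 2 = 0")
    case True
    then have "h 1 = 0" using k(3) by simp
    then have h0: "binary_form 4 h y z = h 0 * (z * z)\<^sup>2" for y z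
      unfolding h2 True by (simp add: power2_eq_square)
    have "h 0 \<noteq> 0"
      using shift_inverse[OF be(1), of 0 "\<lambda>x y z. binary_form 4 c y z" 0 y\<^sub>0 z\<^sub>0] nz
      by (auto simp: Fh h0 simp flip: F_def)
    have "ternary_form 2 (\<lambda>x y z. sqrt (h 0) * (z * z))"
      using ternary_form_mult[OF ternary_form_linear ternary_form_linear, of 0 0 1 0 0 1]
      by (intro ternary_form_cmult) (simp_all add: numeral_2_eq_2)
    moreover have "sqrt (h 0) * (1 * 1) \<noteq> 0" using \<open>h 0 \<noteq> 0\<close> by simp
    ultimately show ?thesis
      by (rule dominates_squareI) (use k(2) in \<open>simp add: Fh h0 power_mult_distrib\<close>)
  next
    case False
    then have h_pos: "h 2 > 0" using k(1) by simp
    define r where "r = sqrt (h 2)"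
    have r: "r > 0" "r\<^sup>2 = h 2" using h_pos by (auto simp: r_def)
    have "ternary_form 2 (\<lambda>x y z. z * (0 * x + r * y + h 1 / (2 * r) * z))"
      using ternary_form.times_z[OF ternary_form_linear[of 0 r "h 1 / (2 * r)"]]
      by (simp add: numeral_2_eq_2)
    moreover have "1 * (0 * 0 + r * ((1 - h 1 / (2 * r)) / r) + h 1 / (2 * r) * 1) \<noteq> 0"
      using r by simp
    moreover have "(z * (0 * x + r * y + h 1 / (2 * r) * z))\<^sup>2 \<le> F x y z" for x y z
    proof -
      have "F x y z - (z * (0 * x + r * y + h 1 / (2 * r) * z))\<^sup>2
          = (z\<^sup>2)\<^sup>2 * (h 0 - (h 1 / 2)\<^sup>2 / h 2)"
        using r(1) unfolding Fh h2 r(2)[symmetric] by (simp add: field_simps power2_eq_square)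
      moreover have "(h 1 / 2)\<^sup>2 / h 2 \<le> h 0"
        using k(3) h_pos by (simp add: field_simps)
      ultimately show ?thesis
        by (metis diff_ge_0_iff_ge mult_nonneg_nonneg zero_le_power2)
    qed
    ultimately show ?thesis by (rule dominates_squareI)
  qed
  then show ?thesis
    unfolding F_def by (rule dominates_square_shift[OF be(1)])
qed

text \<open>The zero removes \<open>x ^ 4\<close>, and then nonnegativity removes \<open>x ^ 3\<close>.  The coefficient of \<open>x\<close> is halved
  so that the discriminant is \<open>f h - g\<^sup>2\<close>.\<close>

lemma expand_at_zero:
  assumes F: "ternary_form 4 F" and nonneg: "\<And>x y z. 0 \<le> F x y z" and "F 1 0 0 = 0"
  obtains f g h where
    "\<And>x y z. F x y z = x\<^sup>2 * binary_form 2 f y z + 2 * x * binary_form 3 g y z + binary_form 4 h y z"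
proof -
  obtain c where c: "F x y z = (\<Sum>k\<le>4. x ^ k * binary_form (4 - k) (c k) y z)" for x y z
    using ternary_form_expand[OF F] by blast
  have "c 4 0 = 0"
    using assms(3) by (simp add: c atMost_4 binary_form_at_0 binary_form_def[of 0])
  then have "binary_form 0 (c 4) y z = 0" for y z by (simp add: binary_form_def)
  then have c3: "F x y z = binary_form 1 (c 3) y z * x ^ 3 + binary_form 2 (c 2) y z * x\<^sup>2
      + binary_form 3 (c 1) y z * x + binary_form 4 (c 0) y z" for x y z
    by (simp add: c atMost_4)
  have "binary_form 1 (c 3) y z = 0" for y z
    using nonneg[of _ y z] unfolding c3 by (rule nonneg_cubic)
  moreover have "binary_form 3 (c 1) y z = 2 * binary_form 3 (\<lambda>i. c 1 i / 2) y z" for y z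
    by (simp add: binary_form_def sum_distrib_left)
  ultimately show ?thesis
    by (intro that[of "c 2" "\<lambda>i. c 1 i / 2" "c 0"]) (simp add: c3)
qed

lemma square_of_balanced_sum:
  fixes s u v :: real
  assumes "s \<noteq> 0"
  shows "(s * u + 1 / s * v)\<^sup>2 = s\<^sup>2 * u\<^sup>2 + 2 * u * v + v\<^sup>2 / s\<^sup>2"
  using assms by (simp add: power2_sum power_mult_distrib power_divide)

text \<open>In terms of the expansion \<open>F = x\<^sup>2 f + 2 x g + h\<close>, the second difference in the assumption is
  \<open>2 * f 1 0\<close>; in this form the hypothesis can be transported along substitutions without
  comparing coefficients.  A nonnegative \<open>f\<close> with zero \<open>(1, 0)\<close> is \<open>f\<^sub>0 z\<^sup>2\<close>, and \<open>g\<^sup>2 \<le> f h\<close> makes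
  \<open>g\<close> divisible by \<open>z\<close>.  If \<open>f\<^sub>0 = 0\<close>, the variable \<open>x\<close> does not occur in \<open>F\<close>; otherwise \<open>F\<close>
  is the square of \<open>r x z + g / (r z)\<close> with \<open>r\<^sup>2 = f\<^sub>0\<close> plus a nonnegative binary form.\<close>

lemma dominates_square_cylinder:
  assumes F: "ternary_form 4 F" and nonneg: "\<And>x y z. 0 \<le> F x y z" and nz: "F x\<^sub>0 y\<^sub>0 z\<^sub>0 \<noteq> 0"
    and zero: "F 1 0 0 = 0" "F 1 1 0 + F (- 1) 1 0 = 2 * F 0 1 0"
  shows "dominates_square F"
proof -
  obtain f g h where Fexp:
    "F x y z = x\<^sup>2 * binary_form 2 f y z + 2 * x * binary_form 3 g y z + binary_form 4 h y z" for x y z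
    using expand_at_zero[OF F nonneg zero(1)] by blast
  have f2: "f 2 = 0" using zero(2) by (simp add: Fexp binary_form_at_1_0)
  have "0 \<le> binary_form 2 f y z * x\<^sup>2 + 2 * binary_form 3 g y z * x + binary_form 4 h y z" for x y z
    using nonneg[of x y z] by (simp add: Fexp mult.commute mult.left_commute)
  note disc = nonneg_quadratic[OF this]
  have f1: "f 1 = 0"
  proof -
    have "0 \<le> 0 * t\<^sup>2 + 2 * (f 1 / 2) * t + f 0" for t
      using disc(1)[of t 1] f2 by (simp add: binary_form_2 add.commute)
    from nonneg_quadratic(3)[OF this] show ?thesis by simp
  qed
  have f: "binary_form 2 f y z = f 0 * z\<^sup>2" for y z
    unfolding binary_form_2 f1 f2 by simp
  have "g 3 = 0" using disc(3)[of 1 0] by (simp add: f f2 binary_form_at_1_0)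
  note g = binary_form_divisible_numeral(2)[of g, OF this]
  have f0: "0 \<le> f 0" using disc(1)[of 0 1] by (simp add: f)
  show ?thesis
  proof (cases "f 0 = 0")
    case True
    then have "binary_form 3 g y z = 0" for y z using disc(3)[of y z] by (simp add: f)
    then have Fh: "F x y z = binary_form 4 h y z" for x y z using True by (simp add: Fexp f)
    then have "F = (\<lambda>x y z. binary_form 4 h y z)" by blast
    then show ?thesis using dominates_square_binary[of h y\<^sub>0 z\<^sub>0] disc(2) nz by simp
  next
    case False
    define r where "r = sqrt (f 0)"
    have r: "r > 0" "r\<^sup>2 = f 0" using f0 False by (auto simp: r_def)
    define q where "q x y z = r * (x * z) + 1 / r * binary_form 2 g y z" for x y z
    have "ternary_form 2 q"
      unfolding q_def[abs_def]
      using ternary_form_mult[OF ternary_form_linear ternary_form_linear, of 1 0 0 0 0 1]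
      by (intro ternary_form_cmult ternary_form.add binary_form_ternary) (simp_all add: numeral_2_eq_2)
    moreover have "q 1 0 1 \<noteq> 0 \<or> q 0 0 1 \<noteq> 0" using r by (auto simp: q_def)
    moreover have "(q x y z)\<^sup>2 \<le> F x y z" for x y z
    proof -
      let ?d = "\<lambda>z. binary_form 4 h y z - (binary_form 2 g y z)\<^sup>2 / f 0"
      have off_line: "0 \<le> ?d t" if "t \<noteq> 0" for t
      proof -
        have "t\<^sup>2 * (binary_form 2 g y t)\<^sup>2 \<le> t\<^sup>2 * (f 0 * binary_form 4 h y t)"
          using disc(3)[of y t] by (simp add: f g power_mult_distrib mult_ac)
        then have "(binary_form 2 g y t)\<^sup>2 \<le> f 0 * binary_form 4 h y t"
          using that by (simp add: mult_le_cancel_left)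
        then show ?thesis using f0 False by (simp add: divide_le_eq mult.commute)
      qed
      have "0 \<le> ?d 0"
        by (rule nonneg_at_limit[OF _ off_line]) (intro continuous_intros, use False in auto)
      then have "0 \<le> ?d z" using off_line by (cases "z = 0") auto
      moreover have "F x y z = (q x y z)\<^sup>2 + ?d z"
      proof -
        have "(q x y z)\<^sup>2 = r\<^sup>2 * (x * z)\<^sup>2 + 2 * (x * z) * binary_form 2 g y z
            + (binary_form 2 g y z)\<^sup>2 / r\<^sup>2"
          unfolding q_def by (rule square_of_balanced_sum) (use r in simp)
        then show ?thesis
          unfolding r(2) Fexp f g by (simp add: power_mult_distrib mult_ac)
      qed
      ultimately show ?thesis by simp
    qed
    ultimately show ?thesis using dominates_squareI by blast
  qed
qed

text \<open>A substitution in \<open>y\<close> and \<open>z\<close> alone moves the zero \<open>(b, e)\<close> of the leading coefficient \<open>f\<close> to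
  \<open>(1, 0)\<close>.\<close>

lemma dominates_square_degenerate:
  assumes F: "ternary_form 4 F" and nonneg: "\<And>x y z. 0 \<le> F x y z" and nz: "F x\<^sub>0 y\<^sub>0 z\<^sub>0 \<noteq> 0"
    and zero: "F 1 0 0 = 0" "F 1 b e + F (- 1) b e = 2 * F 0 b e" and be: "(b, e) \<noteq> (0, 0)"
  shows "dominates_square F"
proof (rule dominates_square_shift[OF be])
  obtain u v w where uvw: "shift 0 b e F u v w \<noteq> 0"
    by (rule shift_nonzero[OF be, of F, OF nz])
  show "dominates_square (shift 0 b e F)"
  proof (rule dominates_square_cylinder)
    show "ternary_form 4 (shift 0 b e F)" by (rule ternary_form_shift[OF F])
    show "shift 0 b e F u v w \<noteq> 0" by (rule uvw)
  qed (use nonneg zero in \<open>simp_all add: shift_def\<close>)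
qed

text \<open>The linear form \<open>e y - b z\<close> is the one that vanishes at \<open>(b, e)\<close>.\<close>

lemma binary_quadratic_factor:
  assumes zero: "binary_form 2 c b e = 0" and be: "(b, e) \<noteq> (0, 0)"
  obtains p r where "\<And>y z. binary_form 2 c y z = (e * y - b * z) * (p * y + r * z)"
proof -
  have z: "c 0 * e\<^sup>2 + c 1 * b * e + c 2 * b\<^sup>2 = 0" using zero by (simp add: binary_form_2)
  show thesis
  proof (cases "e = 0")
    case True
    then have "c 2 = 0" "b \<noteq> 0" using z be by auto
    then show ?thesis using True
      by (intro that[of "- c 1 / b" "- c 0 / b"]) (simp add: binary_form_2 field_simps power2_eq_square)
  next
    case False
    define p where "p = c 2 / e"
    define r where "r = (c 1 + b * p) / e"
    have pr: "c 2 = e * p" "c 1 = e * r - b * p" using False by (auto simp: p_def r_def)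
    have "(c 0 + b * r) * e\<^sup>2 = 0" using z unfolding pr by (simp add: algebra_simps power2_eq_square)
    then have c0: "c 0 = - (b * r)" using False by simp
    show ?thesis
      by (rule that[of p r]) (unfold binary_form_2 pr c0, simp add: algebra_simps power2_eq_square)
  qed
qed

text \<open>In \<open>(e y - b z) (p y + r z)\<close> the discriminant is \<open>(e r + b p)\<^sup>2\<close>.  Nonnegativity makes it vanish, so
  that the two factors are proportional.\<close>

lemma nonneg_binary_quadratic_zero:
  assumes nonneg: "\<And>y z. 0 \<le> binary_form 2 c y z"
    and zero: "binary_form 2 c b e = 0" and be: "(b, e) \<noteq> (0, 0)"
  obtains k where "0 \<le> k" "\<And>y z. binary_form 2 c y z = k * (e * y - b * z)\<^sup>2"
proof -
  obtain p r where pr: "binary_form 2 c y z = (e * y - b * z) * (p * y + r * z)" for y z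
    using binary_quadratic_factor[OF zero be] by blast
  have P: "0 \<le> (e * p) * t\<^sup>2 + (e * r - b * p) * t - b * r" for t
    using nonneg[of t 1] by (simp add: pr algebra_simps power2_eq_square)
  have "0 \<le> (e * p) * t\<^sup>2 + 2 * ((e * r - b * p) / 2) * t + (- (b * r))" for t
    using P[of t] by (simp add: field_simps)
  from nonneg_quadratic(3)[OF this] have "(e * r + b * p)\<^sup>2 \<le> 0"
    by (simp add: power2_eq_square field_simps)
  then have er: "e * r = - (b * p)" by simp
  define k where "k = (if e = 0 then - r / b else p / e)"
  have "p = k * e" "r = - (k * b)" using er be by (auto simp: k_def field_simps)
  then have k: "binary_form 2 c y z = k * (e * y - b * z)\<^sup>2" for y z
    by (simp add: pr power2_eq_square algebra_simps)
  moreover have "0 \<le> k"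
  proof -
    have "0 \<le> k * (e * e - b * - b)\<^sup>2" using nonneg[of e "- b"] by (simp add: k)
    moreover have "e * e - b * - b \<noteq> 0"
      using be sum_squares_eq_zero_iff[of e b] by auto
    ultimately show ?thesis using be by (auto simp: zero_le_mult_iff)
  qed
  ultimately show ?thesis using that by blast
qed

text \<open>With zeros at \<open>(1, 0, 0)\<close> and \<open>(0, 1, 0)\<close>, the form is \<open>F = x\<^sup>2 f + 2 x z g + z\<^sup>2 h\<close> for quadratic
  \<open>f\<close>, \<open>g\<close>, \<open>h\<close> in \<open>y\<close> and \<open>z\<close>, and \<open>f F = (x f + z g)\<^sup>2 + z\<^sup>2 D\<close> with \<open>D = f h - g\<^sup>2 \<ge> 0\<close>.  For
  positive definite \<open>f\<close> and \<open>D\<close>, the quotient \<open>D / f\<close> is bounded below by a multiple of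
  \<open>y\<^sup>2 + z\<^sup>2\<close>, and a multiple of \<open>z ^ 4\<close> lies below \<open>F\<close>.

  If \<open>D\<close> vanishes at \<open>(b, e)\<close>, the translation \<open>X = x + a z\<close> with \<open>a = g / f\<close> taken at that point
  changes \<open>g\<close> and \<open>h\<close> into \<open>g\<^sub>1\<close> and \<open>h\<^sub>1\<close> that both vanish there, and leaves \<open>D\<close> unchanged.  For
  \<open>L = e y - b z\<close> this means \<open>h\<^sub>1 = k L\<^sup>2\<close> and \<open>g\<^sub>1 = L M\<close> with a linear form \<open>M\<close>, hence
  \<open>D = L\<^sup>2 (k f - M\<^sup>2)\<close>.  If \<open>k = 0\<close>, then \<open>g\<^sub>1 = 0\<close> and \<open>F = X\<^sup>2 f\<close> is at least a multiple
  of \<open>(X z)\<^sup>2\<close>.  If \<open>k > 0\<close>, then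
  \<open>F = k (z L + X M / k)\<^sup>2 + X\<^sup>2 (f - M\<^sup>2 / k)\<close>, where the last factor is nonnegative.\<close>

lemma dominates_square_two_zeros:
  assumes F: "ternary_form 4 F" and nonneg: "\<And>x y z. 0 \<le> F x y z" and nz: "F x\<^sub>0 y\<^sub>0 z\<^sub>0 \<noteq> 0"
    and zero: "F 1 0 0 = 0" "F 0 1 0 = 0"
  shows "dominates_square F"
proof -
  obtain f' g' h' where Fexp:
    "F x y z = x\<^sup>2 * binary_form 2 f' y z + 2 * x * binary_form 3 g' y z + binary_form 4 h' y z" for x y z
    using expand_at_zero[OF F nonneg zero(1)] by blast
  have "h' 4 = 0" using zero(2) by (simp add: Fexp binary_form_at_1_0)
  note h3 = binary_form_divisible_numeral(1)[of h', OF this]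
  have "h' 3 = 0"
    by (rule nonneg_cubic[of _ "h' 2" "h' 1" "h' 0"])
      (use nonneg[of 0 _ 1] in \<open>simp add: Fexp h3 binary_form_3_at_1\<close>)
  note h2 = h3[unfolded binary_form_divisible_numeral(2)[of h', OF this]]
  have "2 * g' 3 = 0"
    by (rule nonneg_cubic[of _ "f' 2" 0 0])
      (use nonneg[of 1 _ 0] binary_form_scale[of 2 f' _ 1 0] binary_form_scale[of 3 g' _ 1 0] in
        \<open>simp add: Fexp h3 binary_form_at_1_0 mult_ac add_ac\<close>)
  then have "g' 3 = 0" by simp
  note g2 = binary_form_divisible_numeral(2)[of g', OF this]
  define f g h where "f = binary_form 2 f'" and "g = binary_form 2 g'" and "h = binary_form 2 h'"
  have Fx: "F x y z = x\<^sup>2 * f y z + 2 * x * z * g y z + z\<^sup>2 * h y z" for x y z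
    by (simp add: Fexp g2 h2 f_def g_def h_def power2_eq_square)
  define D where "D y z = f y z * h y z - (g y z)\<^sup>2" for y z
  have fF: "f y z * F x y z = (x * f y z + z * g y z)\<^sup>2 + z\<^sup>2 * D y z" for x y z
    by (simp add: Fx D_def algebra_simps power2_eq_square)
  have "0 \<le> f y z * x\<^sup>2 + 2 * (z * g y z) * x + z\<^sup>2 * h y z" for x y z
    using nonneg[of x y z] by (simp add: Fx mult_ac)
  note disc = nonneg_quadratic[OF this]
  have D_nonneg: "0 \<le> D y z" for y z
  proof -
    have off_line: "0 \<le> D y t" if "t \<noteq> 0" for t
    proof -
      have "0 \<le> t\<^sup>2 * D y t"
        using disc(3)[of t y] by (simp add: D_def algebra_simps power_mult_distrib)
      then show ?thesis using that by (simp add: zero_le_mult_iff)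
    qed
    have "0 \<le> D y 0"
      by (rule nonneg_at_limit[OF _ off_line])
        (unfold D_def f_def g_def h_def, intro continuous_intros)
    then show ?thesis using off_line by (cases "z = 0") auto
  qed
  show ?thesis
  proof (cases "\<exists>b e. (b, e) \<noteq> (0, 0) \<and> f b e = 0")
    case True
    then obtain b e where "(b, e) \<noteq> (0, 0)" "f b e = 0" by blast
    then show ?thesis
      by (intro dominates_square_degenerate[OF F nonneg nz zero(1), of b e]) (simp_all add: Fx)
  next
    case f_pos: False
    then have f_pos: "0 < f y z" if "(y, z) \<noteq> (0, 0)" for y z
      using that disc(1)[of y z] by (metis less_le)
    have f00: "f 0 0 = 0" by (simp add: f_def binary_form_at_0)
    show ?thesis
    proof (cases "\<exists>b e. (b, e) \<noteq> (0, 0) \<and> D b e = 0")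
      case False
      have "\<exists>\<epsilon>>0. \<forall>y z. (y, z) \<noteq> (0, 0) \<longrightarrow> \<epsilon> * (y\<^sup>2 + z\<^sup>2) ^ 1 \<le> D y z / f y z"
      proof (rule binary_lower_bound)
        show "continuous_on (- {0}) (\<lambda>p. D (fst p) (snd p) / f (fst p) (snd p))"
          using f_pos by (unfold D_def f_def g_def h_def, intro continuous_intros)
            (auto simp: zero_prod_def prod_eq_iff less_le)
        show "D (t * y) (t * z) / f (t * y) (t * z) = t ^ (2 * 1) * (D y z / f y z)"
          if "t > 0" for t y z
        proof -
          have "D (t * y) (t * z) = t ^ 4 * D y z" "f (t * y) (t * z) = t\<^sup>2 * f y z"
            by (simp_all add: D_def f_def g_def h_def binary_form_scale power_mult_distrib
                right_diff_distrib)
          then show ?thesis using that by (simp add: eval_nat_numeral)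
        qed
        show "0 < D y z / f y z" if "(y, z) \<noteq> (0, 0)" for y z
          using that False D_nonneg[of y z] f_pos[of y z] by (metis divide_pos_pos less_le)
      qed
      then obtain \<epsilon> where \<epsilon>: "\<epsilon> > 0"
        "\<And>y z. (y, z) \<noteq> (0, 0) \<Longrightarrow> \<epsilon> * (y\<^sup>2 + z\<^sup>2) \<le> D y z / f y z"
        by auto
      have "ternary_form 2 (\<lambda>x y z. sqrt \<epsilon> * (z * z))"
        using ternary_form_mult[OF ternary_form_linear ternary_form_linear, of 0 0 1 0 0 1]
        by (intro ternary_form_cmult) (simp_all add: numeral_2_eq_2)
      moreover have "sqrt \<epsilon> * (1 * 1) \<noteq> 0" using \<epsilon> by simp
      moreover have "(sqrt \<epsilon> * (z * z))\<^sup>2 \<le> F x y z" for x y z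
      proof (cases "z = 0")
        case True
        then show ?thesis using nonneg by simp
      next
        case z: False
        have "(sqrt \<epsilon> * (z * z))\<^sup>2 = z\<^sup>2 * (\<epsilon> * z\<^sup>2)"
          using \<epsilon>(1) by (simp add: power_mult_distrib power2_eq_square)
        also have "\<dots> \<le> z\<^sup>2 * (\<epsilon> * (y\<^sup>2 + z\<^sup>2))"
          using \<epsilon>(1) by (intro mult_left_mono) auto
        also have "\<dots> \<le> z\<^sup>2 * (D y z / f y z)"
          using \<epsilon>(2)[of y z] z by (intro mult_left_mono) auto
        also have "\<dots> \<le> F x y z"
          using fF[of y z x] f_pos[of y z] z by (simp add: field_simps)
        finally show ?thesis .
      qed
      ultimately show ?thesis by (rule dominates_squareI)
    next
      case True
      then obtain b e where be: "(b, e) \<noteq> (0, 0)" and D0: "D b e = 0" by blast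
      define a where "a = g b e / f b e"
      define g\<^sub>1 where "g\<^sub>1 i = g' i - a * f' i" for i
      define h\<^sub>1 where "h\<^sub>1 i = h' i - 2 * a * g' i + a\<^sup>2 * f' i" for i
      have g1: "binary_form 2 g\<^sub>1 y z = g y z - a * f y z" for y z
        by (simp add: binary_form_2 g\<^sub>1_def f_def g_def algebra_simps)
      have h1: "binary_form 2 h\<^sub>1 y z = h y z - 2 * a * g y z + a\<^sup>2 * f y z" for y z
        by (simp add: binary_form_2 h\<^sub>1_def f_def g_def h_def algebra_simps)
      have D1: "D y z = f y z * binary_form 2 h\<^sub>1 y z - (binary_form 2 g\<^sub>1 y z)\<^sup>2" for y z
        by (simp add: D_def g1 h1 algebra_simps power2_eq_square)
      have FX: "F x y z = (x + a * z)\<^sup>2 * f y z + 2 * (x + a * z) * z * binary_form 2 g\<^sub>1 y z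
          + z\<^sup>2 * binary_form 2 h\<^sub>1 y z" for x y z
        by (simp add: Fx g1 h1 algebra_simps power2_eq_square)
      have fbe: "f b e > 0" by (rule f_pos[OF be])
      have g10: "binary_form 2 g\<^sub>1 b e = 0" using fbe by (simp add: g1 a_def)
      have "f b e * binary_form 2 h\<^sub>1 b e = 0" using D0 by (simp add: D1 g10)
      then have h10: "binary_form 2 h\<^sub>1 b e = 0" using fbe by simp
      have "0 \<le> binary_form 2 h\<^sub>1 y z" for y z
      proof (cases "(y, z) = (0, 0)")
        case False
        have "0 \<le> f y z * binary_form 2 h\<^sub>1 y z"
          using D_nonneg[of y z] zero_le_power2[of "binary_form 2 g\<^sub>1 y z"] unfolding D1 by linarith
        then show ?thesis using f_pos[OF False] by (simp add: zero_le_mult_iff)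
      qed (simp add: binary_form_at_0)
      then obtain k where k: "0 \<le> k" "\<And>y z. binary_form 2 h\<^sub>1 y z = k * (e * y - b * z)\<^sup>2"
        using nonneg_binary_quadratic_zero[OF _ h10 be] by blast
      obtain p r where pr: "\<And>y z. binary_form 2 g\<^sub>1 y z = (e * y - b * z) * (p * y + r * z)"
        using binary_quadratic_factor[OF g10 be] by blast
      show ?thesis
      proof (cases "k = 0")
        case True
        then have "binary_form 2 g\<^sub>1 y z = 0" for y z
          using D_nonneg[of y z] by (simp add: D1 k(2))
        then have FX: "F x y z = (x + a * z)\<^sup>2 * f y z" for x y z
          using True by (simp add: FX k(2))
        have "\<exists>\<epsilon>>0. \<forall>y z. (y, z) \<noteq> (0, 0) \<longrightarrow> \<epsilon> * (y\<^sup>2 + z\<^sup>2) ^ 1 \<le> f y z"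
          by (rule binary_lower_bound)
            (use f_pos in \<open>auto simp: f_def binary_form_scale intro!: continuous_intros\<close>)
        then obtain \<epsilon> where \<epsilon>: "\<epsilon> > 0"
          "\<And>y z. (y, z) \<noteq> (0, 0) \<Longrightarrow> \<epsilon> * (y\<^sup>2 + z\<^sup>2) \<le> f y z"
          by auto
        have "ternary_form 2 (\<lambda>x y z. sqrt \<epsilon> * (z * (1 * x + 0 * y + a * z)))"
          using ternary_form.times_z[OF ternary_form_linear[of 1 0 a]]
          by (intro ternary_form_cmult) (simp add: numeral_2_eq_2)
        moreover have "sqrt \<epsilon> * (1 * (1 * (1 - a) + 0 * 0 + a * 1)) \<noteq> 0" using \<epsilon> by simp
        moreover have "(sqrt \<epsilon> * (z * (1 * x + 0 * y + a * z)))\<^sup>2 \<le> F x y z" for x y z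
        proof -
          have "(sqrt \<epsilon> * (z * (1 * x + 0 * y + a * z)))\<^sup>2 = (x + a * z)\<^sup>2 * (\<epsilon> * z\<^sup>2)"
            using \<epsilon>(1) by (simp add: power_mult_distrib)
          also have "\<dots> \<le> (x + a * z)\<^sup>2 * (\<epsilon> * (y\<^sup>2 + z\<^sup>2))"
            using \<epsilon>(1) by (intro mult_left_mono) auto
          also have "\<dots> \<le> (x + a * z)\<^sup>2 * f y z"
            using \<epsilon>(2)[of y z] f00 by (intro mult_left_mono) (cases "(y, z) = (0, 0)", auto)
          finally show ?thesis by (simp only: FX)
        qed
        ultimately show ?thesis by (rule dominates_squareI)
      next
        case False
        define s where "s = sqrt k"
        have s: "s > 0" "s\<^sup>2 = k" using k(1) False by (auto simp: s_def)
        define q where "q x y z = s * (z * (0 * x + e * y + (- b) * z)) +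
          1 / s * ((1 * x + 0 * y + a * z) * (0 * x + p * y + r * z))" for x y z
        have "ternary_form 2 q"
          using ternary_form.times_z[OF ternary_form_linear[of 0 e "- b"]]
            ternary_form_mult[OF ternary_form_linear ternary_form_linear, of 1 0 a 0 p r]
          unfolding q_def[abs_def]
          by (intro ternary_form.add ternary_form_cmult) (simp_all add: numeral_2_eq_2)
        moreover have "\<exists>y. q (- a) y 1 \<noteq> 0"
        proof (cases "e = 0")
          case True
          then show ?thesis using be s by (intro exI[of _ 0]) (simp add: q_def)
        next
          case False
          then show ?thesis using s by (intro exI[of _ "(b + 1) / e"]) (simp add: q_def)
        qed
        moreover have "(q x y z)\<^sup>2 \<le> F x y z" for x y z
        proof -
          let ?R = "\<lambda>y z. f y z - (p * y + r * z)\<^sup>2 / k"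
          have off_line: "0 \<le> ?R y z" if "e * y - b * z \<noteq> 0" for y z
          proof -
            have "D y z = (e * y - b * z)\<^sup>2 * (k * ?R y z)"
              using False by (simp add: D1 pr k(2) right_diff_distrib power_mult_distrib mult_ac)
            then show ?thesis
              using D_nonneg[of y z] that k(1) False by (simp add: zero_le_mult_iff)
          qed
          have "0 \<le> ?R y z"
          proof (cases "e * y - b * z = 0")
            case True
            have "0 \<le> ?R (y + 0 * e) (z - 0 * b)"
            proof (rule nonneg_at_limit[where a = 0 and g = "\<lambda>t. ?R (y + t * e) (z - t * b)"])
              show "continuous_on UNIV (\<lambda>t. ?R (y + t * e) (z - t * b))"
                unfolding f_def by (intro continuous_intros) (use False in auto)
              \<comment> \<open>The direction \<open>(e, - b)\<close> is transversal to the line \<open>e y = b z\<close>.\<close>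
              show "0 \<le> ?R (y + t * e) (z - t * b)" if "t \<noteq> 0" for t
              proof (rule off_line)
                have "e * (y + t * e) - b * (z - t * b) = t * (e * e + b * b)"
                  using True by (simp add: algebra_simps)
                then show "e * (y + t * e) - b * (z - t * b) \<noteq> 0"
                  using that be by (auto simp: sum_squares_eq_zero_iff)
              qed
            qed
            then show ?thesis by simp
          qed (rule off_line)
          moreover have "F x y z = (q x y z)\<^sup>2 + (x + a * z)\<^sup>2 * ?R y z"
          proof -
            define X L M where "X = x + a * z" and "L = e * y - b * z" and "M = p * y + r * z"
            have q: "q x y z = s * (z * L) + 1 / s * (X * M)"
              by (simp add: q_def X_def L_def M_def)
            have "(q x y z)\<^sup>2 = k * (z * L)\<^sup>2 + 2 * (z * L) * (X * M) + (X * M)\<^sup>2 / k"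
              unfolding q s(2)[symmetric] by (rule square_of_balanced_sum) (use s in simp)
            then show ?thesis
              unfolding FX pr k(2) X_def[symmetric] L_def[symmetric] M_def[symmetric]
              by (simp add: power_mult_distrib right_diff_distrib mult_ac)
          qed
          ultimately show ?thesis by simp
        qed
        ultimately show ?thesis using dominates_squareI by blast
      qed
    qed
  qed
qed

text \<open>Where the discriminant \<open>f h - g\<^sup>2\<close> vanishes, the quadratic polynomial in \<open>x\<close> has the double root
  \<open>- g / f\<close>, which is a second zero of \<open>F\<close>.\<close>

lemma dominates_square_one_zero:
  assumes F: "ternary_form 4 F" and nonneg: "\<And>x y z. 0 \<le> F x y z" and nz: "F x\<^sub>0 y\<^sub>0 z\<^sub>0 \<noteq> 0"
    and zero: "F 1 0 0 = 0"
  shows "dominates_square F"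
proof -
  obtain f' g' h' where Fexp:
    "F x y z = x\<^sup>2 * binary_form 2 f' y z + 2 * x * binary_form 3 g' y z + binary_form 4 h' y z" for x y z
    using expand_at_zero[OF F nonneg zero] by blast
  define f g h where "f = binary_form 2 f'" and "g = binary_form 3 g'" and "h = binary_form 4 h'"
  have Fx: "F x y z = x\<^sup>2 * f y z + 2 * x * g y z + h y z" for x y z
    by (simp add: Fexp f_def g_def h_def)
  define D where "D y z = f y z * h y z - (g y z)\<^sup>2" for y z
  have fF: "f y z * F x y z = (x * f y z + g y z)\<^sup>2 + D y z" for x y z
    by (simp add: Fx D_def algebra_simps power2_eq_square)
  have "0 \<le> f y z * x\<^sup>2 + 2 * g y z * x + h y z" for x y z
    using nonneg[of x y z] by (simp add: Fx mult_ac)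
  note disc = nonneg_quadratic[OF this]
  have D_nonneg: "0 \<le> D y z" for y z using disc(3) by (simp add: D_def)
  show ?thesis
  proof (cases "\<exists>b e. (b, e) \<noteq> (0, 0) \<and> f b e = 0")
    case True
    then obtain b e where "(b, e) \<noteq> (0, 0)" "f b e = 0" by blast
    then show ?thesis
      by (intro dominates_square_degenerate[OF F nonneg nz zero, of b e]) (simp_all add: Fx)
  next
    case False
    then have f_pos: "0 < f y z" if "(y, z) \<noteq> (0, 0)" for y z
      using that disc(1)[of y z] by (metis less_le)
    show ?thesis
    proof (cases "\<exists>b e. (b, e) \<noteq> (0, 0) \<and> D b e = 0")
      case False
      have "\<exists>\<epsilon>>0. \<forall>y z. (y, z) \<noteq> (0, 0) \<longrightarrow> \<epsilon> * (y\<^sup>2 + z\<^sup>2) ^ 2 \<le> D y z / f y z"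
      proof (rule binary_lower_bound)
        show "continuous_on (- {0}) (\<lambda>p. D (fst p) (snd p) / f (fst p) (snd p))"
          using f_pos by (unfold D_def f_def g_def h_def, intro continuous_intros)
            (auto simp: zero_prod_def prod_eq_iff less_le)
        show "D (t * y) (t * z) / f (t * y) (t * z) = t ^ (2 * 2) * (D y z / f y z)"
          if "t > 0" for t y z
        proof -
          have t6: "t\<^sup>2 * t ^ 4 = t ^ 6" "(t ^ 3)\<^sup>2 = t ^ 6"
            by (simp_all flip: power_add power_mult)
          have "D (t * y) (t * z) = (t\<^sup>2 * t ^ 4) * (f y z * h y z) - (t ^ 3)\<^sup>2 * (g y z)\<^sup>2"
            by (simp only: D_def f_def g_def h_def binary_form_scale power_mult_distrib mult_ac)
          then have "D (t * y) (t * z) = t\<^sup>2 * t ^ 4 * D y z"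
            unfolding t6 by (simp only: D_def right_diff_distrib)
          moreover have "f (t * y) (t * z) = t\<^sup>2 * f y z"
            by (simp only: f_def binary_form_scale)
          ultimately have "D (t * y) (t * z) / f (t * y) (t * z)
              = (t\<^sup>2 * (t ^ 4 * D y z)) / (t\<^sup>2 * f y z)"
            by (simp only: mult.assoc)
          also have "\<dots> = t ^ 4 * D y z / f y z"
            by (rule nonzero_mult_divide_mult_cancel_left) (use that in simp)
          finally show ?thesis by simp
        qed
        show "0 < D y z / f y z" if "(y, z) \<noteq> (0, 0)" for y z
          using that False D_nonneg[of y z] f_pos[of y z] by (metis divide_pos_pos less_le)
      qed
      then obtain \<epsilon> where \<epsilon>: "\<epsilon> > 0"
        "\<And>y z. (y, z) \<noteq> (0, 0) \<Longrightarrow> \<epsilon> * (y\<^sup>2 + z\<^sup>2)\<^sup>2 \<le> D y z / f y z"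
        by auto
      have "ternary_form 2 (\<lambda>x y z. sqrt \<epsilon> * (y * y + z * z))"
        using ternary_form_mult[OF ternary_form_linear ternary_form_linear, of 0 1 0 0 1 0]
          ternary_form_mult[OF ternary_form_linear ternary_form_linear, of 0 0 1 0 0 1]
        by (intro ternary_form_cmult ternary_form.add) (simp_all add: numeral_2_eq_2)
      moreover have "sqrt \<epsilon> * (1 * 1 + 0 * 0) \<noteq> 0" using \<epsilon> by simp
      moreover have "(sqrt \<epsilon> * (y * y + z * z))\<^sup>2 \<le> F x y z" for x y z
      proof (cases "(y, z) = (0, 0)")
        case True
        then show ?thesis using nonneg by simp
      next
        case z: False
        have "(sqrt \<epsilon> * (y * y + z * z))\<^sup>2 = \<epsilon> * (y\<^sup>2 + z\<^sup>2)\<^sup>2"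
          using \<epsilon>(1) by (simp add: power_mult_distrib flip: power2_eq_square)
        also have "\<dots> \<le> D y z / f y z" by (rule \<epsilon>(2)[OF z])
        also have "\<dots> \<le> F x y z"
        proof -
          have "D y z \<le> F x y z * f y z" using fF[of y z x] by (simp add: mult.commute)
          then show ?thesis using f_pos[OF z] by (simp add: divide_le_eq)
        qed
        finally show ?thesis .
      qed
      ultimately show ?thesis by (rule dominates_squareI)
    next
      case True
      then obtain b e where be: "(b, e) \<noteq> (0, 0)" and D0: "D b e = 0" by blast
      define a where "a = - g b e / f b e"
      have "f b e * F a b e = 0"
        unfolding fF D0 using f_pos[OF be] by (simp add: a_def)
      then have Fabe: "F a b e = 0" using f_pos[OF be] by simp
      show ?thesis
      proof (rule dominates_square_shift[OF be])
        obtain u v w where uvw: "shift a b e F u v w \<noteq> 0"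
          by (rule shift_nonzero[OF be, of F, OF nz])
        show "dominates_square (shift a b e F)"
        proof (rule dominates_square_two_zeros)
          show "ternary_form 4 (shift a b e F)" by (rule ternary_form_shift[OF F])
          show "shift a b e F u v w \<noteq> 0" by (rule uvw)
        qed (use nonneg zero Fabe in \<open>simp_all add: shift_def\<close>)
      qed
    qed
  qed
qed

theorem nonneg_quartic_dominates_square:
  assumes F: "ternary_form 4 F" and nonneg: "\<And>x y z. 0 \<le> F x y z" and nz: "F x\<^sub>0 y\<^sub>0 z\<^sub>0 \<noteq> 0"
  shows "dominates_square F"
proof (cases "\<exists>a b c. (a, b, c) \<noteq> (0, 0, 0) \<and> F a b c = 0")
  case False
  show ?thesis
  proof (rule dominates_square_positive[OF F])
    show "0 < F x y z" if "(x, y, z) \<noteq> (0, 0, 0)" for x y z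
    proof -
      have "F x y z \<noteq> 0" using False that by blast
      then show ?thesis using nonneg[of x y z] by simp
    qed
  qed
next
  case True
  then obtain a b c where abc: "(a, b, c) \<noteq> (0, 0, 0)" "F a b c = 0" by blast
  show ?thesis
  proof (cases "(b, c) = (0, 0)")
    case True
    have "F a 0 0 = a ^ 4 * F 1 0 0" using ternary_form_scale[OF F, of a 1 0 0] by simp
    then have "F 1 0 0 = 0" using abc True by simp
    then show ?thesis by (rule dominates_square_one_zero[OF F nonneg nz])
  next
    case bc: False
    obtain u v w where uvw: "shift a b c F u v w \<noteq> 0"
      by (rule shift_nonzero[OF bc, of F, OF nz])
    show ?thesis
    proof (rule dominates_square_shift[OF bc, of a], rule dominates_square_swap,
        rule dominates_square_one_zero)
      show "ternary_form 4 (\<lambda>x y z. shift a b c F y x z)"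
        by (rule ternary_form_swap[OF ternary_form_shift[OF F]])
      show "shift a b c F u v w \<noteq> 0" by (rule uvw)
    qed (use nonneg abc in \<open>simp_all add: shift_def\<close>)
  qed
qed

section \<open>Coefficient vectors and moment functionals\<close>

definition monomials4 :: "real \<Rightarrow> real \<Rightarrow> real \<Rightarrow> moment_seq" where
  "monomials4 x y z = (\<chi> e. case Rep_multi_index4 e of (i, j) \<Rightarrow> x ^ i * y ^ j * z ^ (4 - i - j))"

definition monomials2 :: "real \<Rightarrow> real \<Rightarrow> real \<Rightarrow> real ^ multi_index2" where
  "monomials2 x y z = (\<chi> a. case Rep_multi_index2 a of (i, j) \<Rightarrow> x ^ i * y ^ j * z ^ (2 - i - j))"

lemma bij_multi_index2: "bij_betw Rep_multi_index2 UNIV {(i, j). i + j \<le> 2}"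
  by (simp add: bij_betw_def inj_on_def Rep_multi_index2_inject
      type_definition.Rep_range[OF type_definition_multi_index2])

lemma bij_multi_index4: "bij_betw Rep_multi_index4 UNIV {(i, j). i + j \<le> 4}"
  by (simp add: bij_betw_def inj_on_def Rep_multi_index4_inject
      type_definition.Rep_range[OF type_definition_multi_index4])

lemma inner_monomials4:
  "c \<bullet> monomials4 x y z = (\<Sum>(i, j)\<in>{(i, j). i + j \<le> 4}. mom c i j * x ^ i * y ^ j * z ^ (4 - i - j))"
  unfolding inner_vec_def sum.reindex_bij_betw[OF bij_multi_index4, symmetric]
  by (intro sum.cong)
    (auto simp: monomials4_def mom_def case_prod_unfold Rep_multi_index4_inverse)

lemma ternary_form_inner_monomials4: "ternary_form 4 (\<lambda>x y z. c \<bullet> monomials4 x y z)"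
proof -
  have zero: "ternary_form n (\<lambda>x y z. 0)" for n
  proof (induction n)
    case (Suc n)
    show ?case using ternary_form.times_x[OF Suc] by simp
  qed (rule ternary_form.const)
  have powers: "ternary_form i (\<lambda>x y z. x ^ i)" "ternary_form i (\<lambda>x y z. y ^ i)"
    "ternary_form i (\<lambda>x y z. z ^ i)" for i
    by (induction i) (auto intro: ternary_form.intros)
  have "ternary_form 4 (\<lambda>x y z. \<Sum>(i, j)\<in>I. mom c i j * x ^ i * y ^ j * z ^ (4 - i - j))"
    if "finite I" "I \<subseteq> {(i, j). i + j \<le> 4}" for I
    using that
  proof (induction I rule: finite_induct)
    case (insert e I)
    obtain i j where e: "e = (i, j)" by (cases e)
    have "ternary_form (i + j + (4 - i - j)) (\<lambda>x y z. mom c i j * ((x ^ i * y ^ j) * z ^ (4 - i - j)))"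
      by (intro ternary_form_cmult ternary_form_mult powers)
    then show ?case
      using ternary_form.add[OF _ insert.IH, of "\<lambda>x y z. mom c i j * ((x ^ i * y ^ j) * z ^ (4 - i - j))"]
        insert by (simp add: e mult.assoc)
  qed (simp add: zero)
  then show ?thesis
    unfolding inner_monomials4 by (simp add: finite_multi_indices)
qed

lemma ternary_form_2_eq_inner:
  assumes "ternary_form 2 q"
  obtains v where "\<And>x y z. q x y z = v \<bullet> monomials2 x y z"
proof -
  obtain c where
    c: "q x y z = (\<Sum>(i, j)\<in>{(i, j). i + j \<le> 2}. c i j * x ^ i * y ^ j * z ^ (2 - i - j))" for x y z
    using ternary_form_coeffs[OF assms] by blast
  have "q x y z = (\<chi> a. case Rep_multi_index2 a of (i, j) \<Rightarrow> c i j) \<bullet> monomials2 x y z" for x y z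
    unfolding c inner_vec_def sum.reindex_bij_betw[OF bij_multi_index2, symmetric]
    by (intro sum.cong) (auto simp: monomials2_def case_prod_unfold)
  then show ?thesis using that by blast
qed

text \<open>A polynomial in one variable that vanishes identically has zero coefficients; this is applied
  to the powers of \<open>x\<close> and then to those of \<open>y\<close>.\<close>

lemma inner_monomials4_eq_0:
  assumes "\<And>x y. c \<bullet> monomials4 x y 1 = 0"
  shows "c = 0"
proof -
  have I: "{(i, j). i + j \<le> (4::nat)} = (SIGMA i:{..4}. {..4 - i})" by auto
  have "(\<Sum>i\<le>4. (\<Sum>j\<le>4 - i. mom c i j * y ^ j) * x ^ i) = 0" for x y
    using assms[of x y] unfolding inner_monomials4 I
    by (simp add: sum.Sigma[symmetric] sum_distrib_left mult_ac)
  then have "(\<Sum>j\<le>4 - i. mom c i j * y ^ j) = 0" if "i \<le> 4" for i y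
    using polyfun_eq_0[of "\<lambda>i. \<Sum>j\<le>4 - i. mom c i j * y ^ j" 4] that by blast
  then have mom: "mom c i j = 0" if "i \<le> 4" "j \<le> 4 - i" for i j
    using polyfun_eq_0[of "mom c i" "4 - i"] that by blast
  have "c $ e = 0" for e
    using mom[of "fst (Rep_multi_index4 e)" "snd (Rep_multi_index4 e)"] Rep_multi_index4[of e]
    by (simp add: mom_def Rep_multi_index4_inverse case_prod_unfold)
  then show ?thesis by (simp add: vec_eq_iff)
qed

definition index_sum :: "multi_index2 \<Rightarrow> multi_index2 \<Rightarrow> multi_index4" where
  "index_sum a b = Abs_multi_index4 (fst (Rep_multi_index2 a) + fst (Rep_multi_index2 b),
     snd (Rep_multi_index2 a) + snd (Rep_multi_index2 b))"

definition square_coeffs :: "real ^ multi_index2 \<Rightarrow> moment_seq" where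
  "square_coeffs v = (\<chi> e. \<Sum>a\<in>UNIV. \<Sum>b\<in>UNIV. if index_sum a b = e then v $ a * v $ b else 0)"

text \<open>The moment matrix is the matrix of the quadratic form that \<open>y\<close>, read as a linear functional on
  quartics, induces on quadratics by squaring; through this identity its semidefiniteness is used.\<close>

lemma inner_square_coeffs: "y \<bullet> square_coeffs v = v \<bullet> (moment_matrix y *v v)"
proof -
  have "y \<bullet> square_coeffs v
      = (\<Sum>e\<in>UNIV. \<Sum>a\<in>UNIV. \<Sum>b\<in>UNIV. if e = index_sum a b then y $ e * (v $ a * v $ b) else 0)"
    by (simp add: inner_vec_def square_coeffs_def sum_distrib_left if_distrib eq_commute cong: if_cong)
  also have "\<dots> = (\<Sum>a\<in>UNIV. \<Sum>b\<in>UNIV. y $ index_sum a b * (v $ a * v $ b))"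
    by (subst sum.swap, subst sum.swap) (simp add: sum.delta)
  also have "\<dots> = v \<bullet> (moment_matrix y *v v)"
    by (simp add: inner_vec_def matrix_vector_mult_def moment_matrix_def mom_def index_sum_def
        sum_distrib_left mult_ac)
  finally show ?thesis .
qed

text \<open>An instance of \<open>inner_square_coeffs\<close>: the moment matrix of a point evaluation is
  the rank-one matrix of products of monomials.\<close>

lemma square_coeffs_inner_monomials4:
  "square_coeffs v \<bullet> monomials4 x y z = (v \<bullet> monomials2 x y z)\<^sup>2"
proof -
  have "monomials4 x y z $ index_sum a b = monomials2 x y z $ a * monomials2 x y z $ b" for a b
  proof -
    obtain i j k l where ab: "Rep_multi_index2 a = (i, j)" "Rep_multi_index2 b = (k, l)"
      by (metis surj_pair)
    then have le: "i + j \<le> 2" "k + l \<le> 2"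
      using Rep_multi_index2[of a] Rep_multi_index2[of b] by auto
    then have "Rep_multi_index4 (index_sum a b) = (i + k, j + l)"
      by (simp add: index_sum_def ab Abs_multi_index4_inverse)
    moreover have "4 - (i + k) - (j + l) = (2 - i - j) + (2 - k - l)" using le by simp
    ultimately show ?thesis
      by (simp add: monomials4_def monomials2_def ab power_add)
  qed
  then have "moment_matrix (monomials4 x y z) $ a $ b = monomials2 x y z $ a * monomials2 x y z $ b"
    for a b by (simp add: moment_matrix_def mom_def index_sum_def)
  then have "v \<bullet> (moment_matrix (monomials4 x y z) *v v) = (v \<bullet> monomials2 x y z)\<^sup>2"
    by (simp add: inner_vec_def matrix_vector_mult_def power2_eq_square sum_product
        sum_distrib_left mult_ac)
  then show ?thesis using inner_square_coeffs[of "monomials4 x y z" v] by (simp add: inner_commute)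
qed

definition nonneg_quartics :: "moment_seq set" where
  "nonneg_quartics = {c. \<forall>x y z. 0 \<le> c \<bullet> monomials4 x y z}"

lemma closed_nonneg_quartics: "closed nonneg_quartics"
proof -
  have eq: "nonneg_quartics = (\<Inter>x. \<Inter>y. \<Inter>z. {c. 0 \<le> monomials4 x y z \<bullet> c})"
    by (auto simp: nonneg_quartics_def inner_commute)
  show ?thesis unfolding eq by (intro closed_INT ballI closed_halfspace_ge)
qed

text \<open>The evaluations at points of the plane span the whole space, since only the zero vector is
  orthogonal to all of them.  The sum of a basis of evaluations vanishes on a nonnegative quartic only if every
  summand does.\<close>

lemma positive_functional_exists:
  obtains \<mu> where "\<And>c. c \<in> nonneg_quartics \<Longrightarrow> c \<noteq> 0 \<Longrightarrow> 0 < c \<bullet> \<mu>"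
proof -
  obtain B where B: "B \<subseteq> range (\<lambda>(x, y). monomials4 x y 1)" "independent B"
    "range (\<lambda>(x, y). monomials4 x y 1) \<subseteq> span B"
    using basis_exists by metis
  have finB: "finite B" by (rule independent_imp_finite[OF B(2)])
  have "0 < c \<bullet> \<Sum>B" if c: "c \<in> nonneg_quartics" "c \<noteq> 0" for c
  proof -
    have nonneg: "0 \<le> c \<bullet> b" if "b \<in> B" for b
      using B(1) c(1) that by (auto simp: nonneg_quartics_def)
    have "\<exists>b\<in>B. c \<bullet> b \<noteq> 0"
    proof (rule ccontr)
      assume "\<not> ?thesis"
      then have "c \<bullet> v = 0" if "v \<in> span B" for v
        using orthogonal_to_span[OF that, of c] by (simp add: orthogonal_def)
      then have "c = 0" using B(3) by (intro inner_monomials4_eq_0) auto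
      then show False using c(2) by simp
    qed
    then show ?thesis
      unfolding inner_sum_right using finB nonneg by (metis less_le sum_pos2)
  qed
  then show ?thesis using that by blast
qed

text \<open>The coefficient vector \<open>G\<close> minimises \<open>\<phi>\<close>, the quotient of \<open>y\<close> by a strictly positive functional
  \<open>\<mu>\<close>; thus \<open>y \<ge> \<phi> G * \<mu>\<close> on all nonnegative quartics, with equality at \<open>G\<close>.  Applied to \<open>G - d\<close> for
  the coefficient vector \<open>d\<close> of a square below \<open>G\<close>, this gives
  \<open>y \<bullet> d \<le> \<phi> G * (d \<bullet> \<mu>)\<close>, which is negative if \<open>\<phi> G\<close> is.\<close>

lemma psd_moment_matrix_nonneg:
  assumes psd: "positive_semidefinite (moment_matrix y)" and a: "a \<in> nonneg_quartics"
  shows "0 \<le> y \<bullet> a"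
proof (rule ccontr)
  assume neg: "\<not> 0 \<le> y \<bullet> a"
  then have a0: "a \<noteq> 0" by auto
  obtain \<mu> where \<mu>: "\<And>c. c \<in> nonneg_quartics \<Longrightarrow> c \<noteq> 0 \<Longrightarrow> 0 < c \<bullet> \<mu>"
    using positive_functional_exists by blast
  have cone: "r *\<^sub>R c \<in> nonneg_quartics" if "c \<in> nonneg_quartics" "0 \<le> r" for c r
    using that by (simp add: nonneg_quartics_def)
  let ?K = "sphere 0 1 \<inter> nonneg_quartics"
  define \<phi> where "\<phi> c = (y \<bullet> c) / (c \<bullet> \<mu>)" for c
  have \<phi>_scale: "\<phi> (r *\<^sub>R c) = \<phi> c" if "r \<noteq> 0" for r c
    using that by (simp add: \<phi>_def)
  have normed: "c /\<^sub>R norm c \<in> ?K" if "c \<in> nonneg_quartics" "c \<noteq> 0" for c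
    using that by (simp add: cone)
  have \<mu>_K: "c \<bullet> \<mu> \<noteq> 0" if "c \<in> ?K" for c
    using that \<mu>[of c] by (cases "c = 0") (auto simp: dist_norm)
  have "\<exists>G\<in>?K. \<forall>c\<in>?K. \<phi> G \<le> \<phi> c"
  proof (rule continuous_attains_inf)
    show "compact ?K" by (intro compact_Int_closed compact_sphere closed_nonneg_quartics)
    show "?K \<noteq> {}" using normed[OF a a0] by blast
    show "continuous_on ?K \<phi>"
      unfolding \<phi>_def using \<mu>_K by (intro continuous_intros) blast
  qed
  then obtain G where G: "G \<in> nonneg_quartics" "norm G = 1" "\<And>c. c \<in> ?K \<Longrightarrow> \<phi> G \<le> \<phi> c"
    by (auto simp: dist_norm)
  have G0: "G \<noteq> 0" using G(2) by auto
  have min: "\<phi> G * (c \<bullet> \<mu>) \<le> y \<bullet> c" if c: "c \<in> nonneg_quartics" for c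
  proof (cases "c = 0")
    case False
    then have "\<phi> G \<le> \<phi> c"
      using G(3)[OF normed[OF c False]] \<phi>_scale[of "inverse (norm c)" c] by simp
    then show ?thesis using \<mu>[OF c False] by (simp add: \<phi>_def pos_le_divide_eq)
  qed simp
  have "\<phi> G * (a \<bullet> \<mu>) < 0" using min[OF a] neg by simp
  then have \<phi>_neg: "\<phi> G < 0" using \<mu>[OF a a0] by (simp add: mult_less_0_iff)
  obtain x\<^sub>0 y\<^sub>0 z\<^sub>0 where "G \<bullet> monomials4 x\<^sub>0 y\<^sub>0 z\<^sub>0 \<noteq> 0"
    using G0 inner_monomials4_eq_0 by blast
  then have "dominates_square (\<lambda>x y z. G \<bullet> monomials4 x y z)"
    using G(1) by (intro nonneg_quartic_dominates_square ternary_form_inner_monomials4)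
      (auto simp: nonneg_quartics_def)
  then obtain q u v w where q: "ternary_form 2 q" "q u v w \<noteq> 0"
    "\<And>x y z. (q x y z)\<^sup>2 \<le> G \<bullet> monomials4 x y z"
    unfolding dominates_square_def by blast
  obtain p where p: "\<And>x y z. q x y z = p \<bullet> monomials2 x y z"
    using ternary_form_2_eq_inner[OF q(1)] by blast
  define d where "d = square_coeffs p"
  have d: "d \<bullet> monomials4 x y z = (q x y z)\<^sup>2" for x y z
    by (simp add: d_def square_coeffs_inner_monomials4 p)
  have "d \<noteq> 0" using d[of u v w] q(2) by auto
  moreover have "d \<in> nonneg_quartics" by (simp add: nonneg_quartics_def d)
  ultimately have d_pos: "0 < d \<bullet> \<mu>" by (rule \<mu>[rotated])
  have "G - d \<in> nonneg_quartics" using q(3) by (simp add: nonneg_quartics_def inner_diff_left d)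
  from min[OF this] have "\<phi> G * (G \<bullet> \<mu>) - \<phi> G * (d \<bullet> \<mu>) \<le> y \<bullet> G - y \<bullet> d"
    by (simp add: inner_diff_left inner_diff_right right_diff_distrib)
  moreover have "\<phi> G * (G \<bullet> \<mu>) = y \<bullet> G" using \<mu>[OF G(1) G0] by (simp add: \<phi>_def)
  moreover have "\<phi> G * (d \<bullet> \<mu>) < 0" using \<phi>_neg d_pos by (simp add: mult_neg_pos)
  moreover have "0 \<le> y \<bullet> d"
    using psd by (simp add: d_def inner_square_coeffs positive_semidefinite_def)
  ultimately show False by simp
qed

section \<open>Atomic measures and separation\<close>

lemma atomic_representable:
  fixes p :: "'a \<Rightarrow> real ^ 2"
  assumes T: "finite T" and w: "\<And>t. t \<in> T \<Longrightarrow> 0 \<le> w t"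
  shows "(\<Sum>t\<in>T. w t *\<^sub>R monomials4 (p t $ 1) (p t $ 2) 1) \<in> representable_seqs"
proof -
  let ?y = "\<Sum>t\<in>T. w t *\<^sub>R monomials4 (p t $ 1) (p t $ 2) 1"
  let ?M = "point_measure T (\<lambda>t. ennreal (w t))"
  have p: "p \<in> ?M \<rightarrow>\<^sub>M borel" by simp
  have "representing_measure (distr ?M borel p) ?y"
    unfolding representing_measure_def
  proof (intro conjI allI impI)
    fix i j :: nat assume ij: "i + j \<le> 4"
    have f: "(\<lambda>x::real ^ 2. x $ 1 ^ i * x $ 2 ^ j) \<in> borel_measurable borel"
      by (intro borel_measurable_continuous_onI continuous_intros)
    show "integrable (distr ?M borel p) (\<lambda>x. x $ 1 ^ i * x $ 2 ^ j)"
      unfolding integrable_distr_eq[OF p f] by (rule integrable_point_measure_finite[OF T])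
    have "(\<integral>x. x $ 1 ^ i * x $ 2 ^ j \<partial>distr ?M borel p) = (\<Sum>t\<in>T. w t * (p t $ 1 ^ i * p t $ 2 ^ j))"
      unfolding integral_distr[OF p f]
      by (subst lebesgue_integral_point_measure_finite[OF T]) (use w in auto)
    also have "\<dots> = mom ?y i j"
      using ij by (simp add: mom_def monomials4_def Abs_multi_index4_inverse)
    finally show "mom ?y i j = (\<integral>x. x $ 1 ^ i * x $ 2 ^ j \<partial>distr ?M borel p)" by simp
  qed simp
  then show ?thesis by (auto simp: representable_seqs_def)
qed

theorem theorem3p2:
  fixes y :: moment_seq
  assumes "positive_semidefinite (moment_matrix y)"
  shows "y \<in> closure representable_seqs"
proof (rule ccontr)
  assume y: "y \<notin> closure representable_seqs"
  \<comment> \<open>The multiples make the convex hull a cone, so that the separating functional is nonnegative on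
    every evaluation.\<close>
  define E where "E = {r *\<^sub>R monomials4 (p $ 1) (p $ 2) 1 | r (p :: real ^ 2). 0 \<le> r}"
  have "convex hull E \<subseteq> representable_seqs"
  proof
    fix x assume "x \<in> convex hull E"
    then obtain T u where T: "finite T" "T \<subseteq> E" "\<forall>t\<in>T. 0 \<le> u t" "(\<Sum>t\<in>T. u t *\<^sub>R t) = x"
      unfolding convex_hull_explicit by blast
    have "\<forall>t\<in>T. \<exists>r p. 0 \<le> r \<and> t = r *\<^sub>R monomials4 ((p :: real ^ 2) $ 1) (p $ 2) 1"
      using T(2) unfolding E_def by blast
    then obtain r and p :: "moment_seq \<Rightarrow> real ^ 2"
      where rp: "\<And>t. t \<in> T \<Longrightarrow> 0 \<le> r t \<and> t = r t *\<^sub>R monomials4 (p t $ 1) (p t $ 2) 1"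
      by metis
    have "x = (\<Sum>t\<in>T. (u t * r t) *\<^sub>R monomials4 (p t $ 1) (p t $ 2) 1)"
      unfolding T(4)[symmetric] scaleR_scaleR[symmetric] using rp by (intro sum.cong) auto
    also have "\<dots> \<in> representable_seqs"
      using T rp by (intro atomic_representable) auto
    finally show "x \<in> representable_seqs" .
  qed
  then have "y \<notin> closure (convex hull E)" using y closure_mono by blast
  then obtain a b where ab: "a \<bullet> y < b" "\<And>x. x \<in> closure (convex hull E) \<Longrightarrow> b < a \<bullet> x"
    using separating_hyperplane_closed_point[of "closure (convex hull E)" y] by auto
  have E: "b < a \<bullet> x" if "x \<in> E" for x
    using that by (intro ab(2)) (meson closure_subset hull_subset subsetD)
  have ray: "b < r * (a \<bullet> monomials4 x\<^sub>1 x\<^sub>2 1)" if "0 \<le> r" for r x\<^sub>1 x\<^sub>2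
  proof -
    have "r *\<^sub>R monomials4 x\<^sub>1 x\<^sub>2 1 \<in> E"
      unfolding E_def using that by (auto intro!: exI[of _ r] exI[of _ "vector [x\<^sub>1, x\<^sub>2]"])
    from E[OF this] show ?thesis by simp
  qed
  have b: "b < 0" using ray[of 0] by simp
  have affine: "0 \<le> a \<bullet> monomials4 x\<^sub>1 x\<^sub>2 1" for x\<^sub>1 x\<^sub>2
  proof (rule ccontr)
    assume "\<not> ?thesis"
    \<comment> \<open>Along a ray on which \<open>a\<close> is negative, the bound \<open>b\<close> is attained.\<close>
    then show False
      using ray[of "b / (a \<bullet> monomials4 x\<^sub>1 x\<^sub>2 1)" x\<^sub>1 x\<^sub>2] b by (simp add: divide_nonpos_nonpos)
  qed
  \<comment> \<open>Homogeneity extends nonnegativity from the affine plane \<open>z = 1\<close> to \<open>z \<noteq> 0\<close>, and continuity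
    extends it to the line at infinity \<open>z = 0\<close>.\<close>
  have "0 \<le> a \<bullet> monomials4 x\<^sub>1 x\<^sub>2 z" for x\<^sub>1 x\<^sub>2 z
  proof -
    note form = ternary_form_inner_monomials4[of a]
    have off_line: "0 \<le> a \<bullet> monomials4 x\<^sub>1 x\<^sub>2 t" if "t \<noteq> 0" for t
      using ternary_form_scale[OF form, of t "x\<^sub>1 / t" "x\<^sub>2 / t" 1] affine[of "x\<^sub>1 / t" "x\<^sub>2 / t"] that
      by simp
    have "0 \<le> a \<bullet> monomials4 x\<^sub>1 x\<^sub>2 0"
    proof (rule nonneg_at_limit[OF _ off_line])
      show "continuous_on UNIV (\<lambda>t. a \<bullet> monomials4 x\<^sub>1 x\<^sub>2 t)"
        unfolding inner_monomials4 case_prod_unfold by (intro continuous_intros)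
    qed
    then show ?thesis using off_line by (cases "z = 0") auto
  qed
  then have "0 \<le> y \<bullet> a"
    by (intro psd_moment_matrix_nonneg[OF assms]) (simp add: nonneg_quartics_def)
  then show False using ab(1) b by (simp add: inner_commute)
qed

end
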